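(* Let $\gamma\in(0,1)$, $M>0$, and let $\beta_\ast\in(0,\pi/2)$ (depending only on $\gamma$ and $M$) be such that for every $T>0$ and $\beta\in(0,\beta_\ast)$ there is a unique function $$w\in B_{\frac{2+\gamma}4}((0,T];BUC^{3+\gamma}(\mathbb{R}_+))\cap C_{\frac{2+\gamma}4}^{\frac{1+\gamma}4}((0,T];BUC^2(\mathbb{R}_+))$$ which solves $$w(x,t)=-\int_0^t\int_{\mathbb{R}}\partial_xG(x-y,t-\tau)\,(\mathcal{P}f^w)(y,\tau)\,dy\,d\tau+U^w(x,t)\qquad (x\in\mathbb{R}_+,\ t\in(0,T])$$ and satisfies $\|w_x-U^w_x\|_{B([0,T];BUC(\mathbb{R}_+))}\le\tan\beta$ and $$\|w\|_{B_{\frac{2+\gamma}4}((0,T];BUC^{3+\gamma}(\mathbb{R}_+))}+\|w\|_{C_{\frac{2+\gamma}4}^{\frac{1+\gamma}4}((0,T];BUC^2(\mathbb{R}_+))}\le M.$$ Then, if $\beta>0$ is sufficiently small (that is, there is $\beta_1\in(0,\beta_\ast]$ depending only on $\gamma$ and $M$ such that for all $\beta\in(0,\beta_1)$ and $T>0$), this function $w$ satisfies $$t^{-\frac14}w(0,t)\le-\frac{\tan\beta}{\pi}\,\Gamma\Bigl(\frac34\Bigr)<0\qquad\text{for all }t\in(0,T],$$ where $\Gamma$ is the Gamma function. In particular $w\not\equiv0$.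
   Context: Notation. $\mathbb{R}_+=[0,\infty)$. $BUC^\ell(\mathbb{R}_+)$ is the space of $\ell$-times differentiable functions whose derivatives up to order $\ell$ are bounded and uniformly continuous ($BUC=BUC^0$); for $\gamma\in(0,1)$, $BUC^{\ell+\gamma}(\mathbb{R}_+)$ is the set of $w\in BUC^\ell(\mathbb{R}_+)$ with $[\partial_x^\ell w]_\gamma<\infty$, where $[g]_\gamma=\sup_{x\ne y}|g(x)-g(y)|/|x-y|^\gamma$. For the fixed $T>0$ these spaces are given the $T$-weighted norms $$\|w\|_{BUC^\ell}=\sum_{k=0}^\ell T^{-\frac{\ell-k}4}\|\partial_x^kw\|_\infty,\qquad \|w\|_{BUC^{\ell+\gamma}}=\sum_{k=0}^\ell T^{-\frac{\ell-k+\gamma}4}\|\partial_x^kw\|_\infty+[\partial_x^\ell w]_\gamma .$$ For a Banach space $E$: $B_\alpha((0,T];E)$ is the set of $w:(0,T]\to E$ with $\|w\|_{B_\alpha((0,T];E)}:=\sup_{t\in(0,T]}t^\alpha\|w(t)\|_E<\infty$. For $\mu\in(0,1)$, $C_\alpha^\mu((0,T];E)$ is the set of $w\in B_{\alpha-\mu}((0,T];E)$ with $$[w]_{C_\alpha^\mu((0,T];E)}:=\sup_{0<s<t\le T}s^\alpha\frac{\|w(t)-w(s)\|_E}{(t-s)^\mu}<\infty,$$ with norm $\|w\|_{C_\alpha^\mu}=\|w\|_{B_{\alpha-\mu}}+[w]_{C_\alpha^\mu}$. Finally $\|g\|_{B([0,T];BUC(\mathbb{R}_+))}:=\sup_{t\in(0,T]}\|g(\cdot,t)\|_\infty$.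 Green function: $G(x,t)=\frac1\pi\int_0^\infty e^{-\xi^4t}\cos(x\xi)\,d\xi$ for $x\in\mathbb{R}$, $t>0$. Odd extension: for $\varphi\in BUC^\gamma(\mathbb{R}_+)$, $(\mathcal{P}\varphi)(x)=\varphi(x)-\varphi(0)$ if $x\ge0$ and $(\mathcal{P}\varphi)(x)=-(\varphi(-x)-\varphi(0))$ if $x<0$; it is applied in the space variable. Nonlinearity: $$f^w=\Bigl(\frac1{(1+w_x^2)^2}-1\Bigr)w_{xxx}-\frac{3w_x(w_{xx})^2}{(1+w_x^2)^3}.$$ Boundary part: with $c_\beta=\frac{3\tan\beta}{1+\tan^2\beta}$, $$U^w(x,t)=-\frac{2\tan\beta}{\pi}\int_0^\infty\frac{1-e^{-\xi^4t}}{\xi^2}\cos(x\xi)\,d\xi+\frac{2c_\beta}{\pi}\int_0^t\int_0^\infty (w_{xx}(0,\tau))^2e^{-\xi^4(t-\tau)}\cos(x\xi)\,d\xi\,d\tau .$$ *)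

theory Defs
  imports "HOL-Analysis.Analysis"
begin

text \<open>
  A function of \<open>(x, t)\<close> is curried with time first, so that \<open>w t\<close> is its spatial profile,
  an element of the function space \<open>E\<close>. Values at \<open>t \<notin> {0<..T}\<close> or \<open>x < 0\<close> are irrelevant:
  nothing below depends on them. All norms take values in \<open>ennreal\<close>, so that finiteness is a
  genuine condition and not a by-product of the value of \<open>Sup\<close> on an unbounded set of reals.
\<close>

section \<open>Function spaces on the half-line\<close>

text \<open>Spatial derivatives on \<open>{0..}\<close>; at the end point \<open>0\<close> they are one-sided.\<close>

primrec Dx :: "nat \<Rightarrow> (real \<Rightarrow> real) \<Rightarrow> real \<Rightarrow> real" where
  "Dx 0 g = g"
| "Dx (Suc k) g = (\<lambda>x. vector_derivative (Dx k g) (at x within {0..}))"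

definition sup_norm :: "(real \<Rightarrow> real) \<Rightarrow> ennreal" where
  "sup_norm g = (SUP x\<in>{0..}. ennreal \<bar>g x\<bar>)"

definition holder_seminorm :: "real \<Rightarrow> (real \<Rightarrow> real) \<Rightarrow> ennreal" where
  "holder_seminorm \<gamma> g =
     (SUP (x, y)\<in>{(x, y). 0 \<le> x \<and> 0 \<le> y \<and> x \<noteq> y}. ennreal (\<bar>g x - g y\<bar> / \<bar>x - y\<bar> powr \<gamma>))"

definition BUC :: "nat \<Rightarrow> (real \<Rightarrow> real) set" where
  "BUC l = {g. (\<forall>k<l. Dx k g differentiable_on {0..}) \<and>
               (\<forall>k\<le>l. bounded (Dx k g ` {0..}) \<and> uniformly_continuous_on {0..} (Dx k g))}"

definition BUC_holder :: "nat \<Rightarrow> real \<Rightarrow> (real \<Rightarrow> real) set" where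
  "BUC_holder l \<gamma> = {g \<in> BUC l. holder_seminorm \<gamma> (Dx l g) < \<infinity>}"

definition BUC_norm :: "real \<Rightarrow> nat \<Rightarrow> (real \<Rightarrow> real) \<Rightarrow> ennreal" where
  "BUC_norm T l g = (\<Sum>k\<le>l. ennreal (T powr (- (real l - real k) / 4)) * sup_norm (Dx k g))"

definition BUC_holder_norm :: "real \<Rightarrow> nat \<Rightarrow> real \<Rightarrow> (real \<Rightarrow> real) \<Rightarrow> ennreal" where
  "BUC_holder_norm T l \<gamma> g =
     (\<Sum>k\<le>l. ennreal (T powr (- (real l - real k + \<gamma>) / 4)) * sup_norm (Dx k g))
     + holder_seminorm \<gamma> (Dx l g)"

section \<open>Time-weighted spaces\<close>

text \<open>The space \<open>E\<close> of profiles is passed as a set together with its norm \<open>N\<close>.\<close>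

definition B_norm ::
  "real \<Rightarrow> real \<Rightarrow> ((real \<Rightarrow> real) \<Rightarrow> ennreal) \<Rightarrow> (real \<Rightarrow> real \<Rightarrow> real) \<Rightarrow> ennreal" where
  "B_norm \<alpha> T N w = (SUP t\<in>{0<..T}. ennreal (t powr \<alpha>) * N (w t))"

definition B_space ::
  "real \<Rightarrow> real \<Rightarrow> (real \<Rightarrow> real) set \<Rightarrow> ((real \<Rightarrow> real) \<Rightarrow> ennreal) \<Rightarrow> (real \<Rightarrow> real \<Rightarrow> real) set" where
  "B_space \<alpha> T E N = {w. (\<forall>t\<in>{0<..T}. w t \<in> E) \<and> B_norm \<alpha> T N w < \<infinity>}"

definition C_seminorm ::
  "real \<Rightarrow> real \<Rightarrow> real \<Rightarrow> ((real \<Rightarrow> real) \<Rightarrow> ennreal) \<Rightarrow> (real \<Rightarrow> real \<Rightarrow> real) \<Rightarrow> ennreal" where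
  "C_seminorm \<alpha> \<mu> T N w =
     (SUP (s, t)\<in>{(s, t). 0 < s \<and> s < t \<and> t \<le> T}.
        ennreal (s powr \<alpha> / (t - s) powr \<mu>) * N (\<lambda>x. w t x - w s x))"

definition C_space ::
  "real \<Rightarrow> real \<Rightarrow> real \<Rightarrow> (real \<Rightarrow> real) set \<Rightarrow> ((real \<Rightarrow> real) \<Rightarrow> ennreal)
     \<Rightarrow> (real \<Rightarrow> real \<Rightarrow> real) set" where
  "C_space \<alpha> \<mu> T E N = {w \<in> B_space (\<alpha> - \<mu>) T E N. C_seminorm \<alpha> \<mu> T N w < \<infinity>}"

definition C_norm ::
  "real \<Rightarrow> real \<Rightarrow> real \<Rightarrow> ((real \<Rightarrow> real) \<Rightarrow> ennreal) \<Rightarrow> (real \<Rightarrow> real \<Rightarrow> real) \<Rightarrow> ennreal" where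
  "C_norm \<alpha> \<mu> T N w = B_norm (\<alpha> - \<mu>) T N w + C_seminorm \<alpha> \<mu> T N w"

section \<open>The integral equation\<close>

definition Green :: "real \<Rightarrow> real \<Rightarrow> real" where
  "Green x t = 1 / pi * (LBINT \<xi>=0..\<infinity>. exp (- (\<xi> ^ 4 * t)) * cos (x * \<xi>))"

definition Green_x :: "real \<Rightarrow> real \<Rightarrow> real" where
  "Green_x x t = deriv (\<lambda>z. Green z t) x"

definition odd_ext :: "(real \<Rightarrow> real) \<Rightarrow> real \<Rightarrow> real" where
  "odd_ext \<phi> x = (if 0 \<le> x then \<phi> x - \<phi> 0 else - (\<phi> (- x) - \<phi> 0))"

definition nonlin :: "(real \<Rightarrow> real) \<Rightarrow> real \<Rightarrow> real" where
  "nonlin g x =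
     (1 / (1 + (Dx 1 g x)\<^sup>2)\<^sup>2 - 1) * Dx 3 g x
     - 3 * Dx 1 g x * (Dx 2 g x)\<^sup>2 / (1 + (Dx 1 g x)\<^sup>2) ^ 3"

definition c_beta :: "real \<Rightarrow> real" where
  "c_beta \<beta> = 3 * tan \<beta> / (1 + (tan \<beta>)\<^sup>2)"

definition bdry_part :: "real \<Rightarrow> (real \<Rightarrow> real \<Rightarrow> real) \<Rightarrow> real \<Rightarrow> real \<Rightarrow> real" where
  "bdry_part \<beta> w t x =
     - (2 * tan \<beta> / pi) *
         (LBINT \<xi>=0..\<infinity>. (1 - exp (- (\<xi> ^ 4 * t))) / \<xi>\<^sup>2 * cos (x * \<xi>))
     + 2 * c_beta \<beta> / pi *
         (LBINT \<tau>=0..t. (LBINT \<xi>=0..\<infinity>.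
            (Dx 2 (w \<tau>) 0)\<^sup>2 * exp (- (\<xi> ^ 4 * (t - \<tau>))) * cos (x * \<xi>)))"

definition solves_eq :: "real \<Rightarrow> real \<Rightarrow> (real \<Rightarrow> real \<Rightarrow> real) \<Rightarrow> bool" where
  "solves_eq T \<beta> w \<longleftrightarrow>
     (\<forall>t\<in>{0<..T}. \<forall>x\<ge>0.
        w t x = - (LBINT \<tau>=0..t. (LBINT y. Green_x (x - y) (t - \<tau>) * odd_ext (nonlin (w \<tau>)) y))
                + bdry_part \<beta> w t x)"

definition admissible_solution ::
  "real \<Rightarrow> real \<Rightarrow> real \<Rightarrow> real \<Rightarrow> (real \<Rightarrow> real \<Rightarrow> real) \<Rightarrow> bool" where
  "admissible_solution \<gamma> M T \<beta> w \<longleftrightarrow>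
     w \<in> B_space ((2 + \<gamma>) / 4) T (BUC_holder 3 \<gamma>) (BUC_holder_norm T 3 \<gamma>) \<inter>
         C_space ((2 + \<gamma>) / 4) ((1 + \<gamma>) / 4) T (BUC 2) (BUC_norm T 2) \<and>
     solves_eq T \<beta> w \<and>
     (SUP t\<in>{0<..T}. sup_norm (\<lambda>x. Dx 1 (w t) x - Dx 1 (bdry_part \<beta> w t) x))
       \<le> ennreal (tan \<beta>) \<and>
     B_norm ((2 + \<gamma>) / 4) T (BUC_holder_norm T 3 \<gamma>) w
       + C_norm ((2 + \<gamma>) / 4) ((1 + \<gamma>) / 4) T (BUC_norm T 2) w \<le> ennreal M"

end

theory Submission
  imports Defs "HOL-Probability.Sinc_Integral"
begin

text \<open>
  At the boundary the first integral in \<open>bdry_part\<close> equals \<open>- 2 * tan \<beta> / pi * Gamma (3 / 4) * t powr (1 / 4)\<close>,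
  and every other contribution to \<open>w t 0\<close> is \<open>o(tan \<beta>) * t powr (1 / 4)\<close>. A bound of \<open>w_xx\<close> by
  \<open>M * t powr (- 1 / 4)\<close> alone would only give \<open>O(tan \<beta>)\<close>. But \<open>U_x\<close>, hence also \<open>w_x\<close>, is \<open>O(tan \<beta>)\<close>, and
  interpolating between \<open>w_x\<close> and the Hoelder seminorm of \<open>w_xxx\<close> on the parabolic scale \<open>\<delta> * t powr (1 / 4)\<close>
  makes \<open>t powr (1 / 4) * w_xx\<close> small with \<open>tan \<beta>\<close>.
\<close>

section \<open>Integrals in closed form\<close>

text \<open>The bootstrap is not circular: in U_x the crude bound on w_xx enters only through the
  source term, whose factor \<open>c_beta\<close> is already O(tan \<beta>). In w(0,t) the same
  source term must be o(tan \<beta>), and there the improved bound is used. The choice \<delta> =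
  sqrt (tan \<beta>) makes both parts of the interpolation bound vanish: one is of order tan \<beta>
  / \<delta>, the other \<delta> powr (1 + \<gamma>). In the nonlinearity the coefficient of w_xxx
  is quadratic in w_x, and the other term is w_x times the square of w_xx, so both are o(tan
  \<beta>) although w_xxx is merely bounded in its weight. All weights are parabolic: a source of
  size \<tau> powr (- 1 / 2) against a kernel of size (t - \<tau>) powr (- 1 / 4) integrates to a
  multiple of t powr (1 / 4), so the threshold for \<beta> does not see T. The delicate object is
  U_x: it has to exist as a genuine derivative up to x = 0 before its size can be read off from
  \<open>Dx\<close>. This is why differentiation under the integral and measurability in time appear
  there, while the estimates of w(0,t) itself need only pointwise majorants.\<close>

lemma Gamma_set_integral:
  fixes a :: real
  assumes "0 < a"
  shows "set_integrable lborel {0<..} (\<lambda>u. u powr (a - 1) * exp (- u))"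
    and "(LBINT u:{0<..}. u powr (a - 1) * exp (- u)) = Gamma a"
proof -
  let ?f = "\<lambda>u::real. u powr (a - 1) / exp u"
  have hi: "(?f has_integral Gamma a) {0..}"
    by (rule Gamma_integral_real[OF assms])
  have "(?f has_integral Gamma a) {0<..}"
    by (rule has_integral_spike_set_eq[THEN iffD1, OF _ _ hi])
       (auto intro: negligible_subset[of "{0}"])
  moreover have "?f absolutely_integrable_on {0<..}"
    by (rule nonnegative_absolutely_integrable_1)
       (use \<open>(?f has_integral Gamma a) {0<..}\<close> in auto)
  ultimately have *: "set_integrable lebesgue {0<..} ?f" "(LINT u:{0<..}|lebesgue. ?f u) = Gamma a"
    by (auto simp: set_lebesgue_integral_eq_integral integral_unique)
  \<comment> \<open>Borel measurability is what carries the integral from the completed measure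
    \<open>lebesgue\<close> to \<open>lborel\<close>.\<close>
  have m: "(\<lambda>u. indicator {0<..} u *\<^sub>R ?f u) \<in> borel_measurable lborel"
    by measurable
  show "set_integrable lborel {0<..} (\<lambda>u. u powr (a - 1) * exp (- u))"
    using *(1) integrable_completion[OF m] by (simp add: set_integrable_def exp_minus field_simps)
  show "(LBINT u:{0<..}. u powr (a - 1) * exp (- u)) = Gamma a"
    using *(2) integral_completion[OF m] by (simp add: set_lebesgue_integral_def exp_minus field_simps)
qed

text \<open>The substitution \<xi> = (u / t) powr (1 / 4) turns the integrand into a multiple of the
  Gamma integrand with parameter (k + 1) / 4. For a nonnegative integrand the substitution rule
  yields integrability along with the value. The cases k = 0, 1, 2, 3, 7 are used below.\<close>

lemma quartic_moment:
  fixes t :: real and k :: nat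
  assumes "0 < t"
  shows "set_integrable lborel {0<..} (\<lambda>\<xi>. \<xi> ^ k * exp (- (\<xi> ^ 4 * t)))"
    and "(LBINT \<xi>=0..\<infinity>. \<xi> ^ k * exp (- (\<xi> ^ 4 * t)))
           = Gamma ((real k + 1) / 4) / 4 * t powr (- (real k + 1) / 4)"
proof -
  let ?a = "(real k + 1) / 4"
  let ?f = "\<lambda>\<xi>::real. \<xi> ^ k * exp (- (\<xi> ^ 4 * t))"
  let ?g = "\<lambda>u::real. (u / t) powr (1/4)"
  let ?g' = "\<lambda>u::real. (1/4) * (u / t) powr (-3/4) / t"
  let ?c = "t powr (- ?a) / 4"
  have eq: "?f (?g u) * ?g' u = ?c * (u powr (?a - 1) * exp (- u))" if "0 < u" for u
  proof -
    have 1: "(?g u) ^ k = (u / t) powr (k / 4)"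
      using that assms by (simp add: powr_realpow[symmetric] powr_powr)
    have 2: "(?g u) ^ 4 = u / t"
      using that assms by (simp add: powr_realpow[symmetric] powr_powr)
    have "?f (?g u) * ?g' u = (1/4) * ((u / t) powr (k/4) * (u / t) powr (-3/4)) * exp (- u) / t"
      unfolding 1 2 using assms by simp
    also have "(u / t) powr (k/4) * (u / t) powr (-3/4) = (u / t) powr (?a - 1)"
      by (simp add: powr_add[symmetric] field_simps)
    also have "\<dots> = u powr (?a - 1) * t powr (1 - ?a)"
    proof -
      have "(u / t) powr c = u powr c * t powr (- c)" for c
        using that assms by (simp add: powr_divide powr_minus_divide)
      from this[of "?a - 1"] show ?thesis by simp
    qed
    also have "t powr (1 - ?a) = t * t powr (- ?a)"
    proof -
      have "t powr (1 - c) = t * t powr (- c)" for c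
        using powr_add[of t 1 "- c"] assms by simp
      then show ?thesis .
    qed
    finally show ?thesis using assms by simp
  qed
  have ei: "einterval 0 \<infinity> = {0<..}" by (simp add: zero_ereal_def)
  have G: "set_integrable lborel {0<..} (\<lambda>u. u powr (?a - 1) * exp (- u))"
    "(LBINT u:{0<..}. u powr (?a - 1) * exp (- u)) = Gamma ?a"
    using Gamma_set_integral[of ?a] by auto
  have int: "set_integrable lborel {0<..} (\<lambda>u. ?f (?g u) * ?g' u)"
    using set_integrable_mult_right[OF G(1), of ?c]
    by (subst set_integrable_cong[OF refl refl eq]) auto
  have A: "((ereal \<circ> ?g \<circ> real_of_ereal) \<longlongrightarrow> 0) (at_right 0)"
  proof -
    have "(?g \<longlongrightarrow> 0) (at_right 0)"
      by (rule tendsto_eq_intros tendsto_powr' refl | use assms in \<open>auto simp: eventually_at_right_field intro: exI[of _ 1]\<close>)+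
    thus ?thesis 
      unfolding o_def zero_ereal_def by (subst ereal_tendsto_simps1[unfolded o_def]) simp
  qed
  have B: "((ereal \<circ> ?g \<circ> real_of_ereal) \<longlongrightarrow> \<infinity>) (at_left \<infinity>)"
  proof -
    have "filterlim ?g at_top at_top"
      using assms by real_asymp
    thus ?thesis unfolding ereal_tendsto_simps .
  qed
  have S: "set_integrable lborel (einterval 0 \<infinity>) ?f"
      "(LBINT x=0..\<infinity>. ?f x) = (LBINT x=0..\<infinity>. ?f (?g x) * ?g' x)"
    by (rule interval_integral_substitution_nonneg[where g = ?g and g' = ?g'];
        (fact A B)?; use assms int ei in \<open>auto simp: zero_ereal_def intro!: derivative_eq_intros continuous_intros\<close>)+
  show "set_integrable lborel {0<..} ?f" using S ei by simp
  note S(2)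
  also have "(LBINT x=0..\<infinity>. ?f (?g x) * ?g' x) = (LBINT x:{0<..}. ?c * (x powr (?a - 1) * exp (- x)))"
    unfolding interval_lebesgue_integral_0_infty
    by (rule set_lebesgue_integral_cong) (use eq in auto)
  also have "\<dots> = ?c * Gamma ?a" using G by simp
  finally show "(LBINT x=0..\<infinity>. ?f x) = Gamma ?a / 4 * t powr (- (real k + 1) / 4)" by (simp add: minus_divide_left)
qed

text \<open>This is the source of the main term. Integration by parts with the primitive
  \<open>- 1 / \<xi>\<close> of \<open>1 / \<xi>\<^sup>2\<close> has no boundary terms and leaves 4
  t times the second quartic moment.\<close>

lemma one_minus_exp_quartic_integral:
  fixes t :: real
  assumes "0 < t"
  shows "set_integrable lborel {0<..} (\<lambda>\<xi>. (1 - exp (- (\<xi> ^ 4 * t))) / \<xi>\<^sup>2)"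
    and "(LBINT \<xi>=0..\<infinity>. (1 - exp (- (\<xi> ^ 4 * t))) / \<xi>\<^sup>2) = Gamma (3 / 4) * t powr (1 / 4)"
proof -
  let ?f = "\<lambda>\<xi>::real. (1 - exp (- (\<xi> ^ 4 * t))) / \<xi>\<^sup>2"
  let ?h = "\<lambda>\<xi>::real. 4 * t * (\<xi> ^ 2 * exp (- (\<xi> ^ 4 * t)))"
  let ?F = "\<lambda>\<xi>::real. - (1 - exp (- (\<xi> ^ 4 * t))) / \<xi>"
  have ei: "einterval 0 \<infinity> = {0<..}" by (simp add: zero_ereal_def)
  \<comment> \<open>Near 0 the numerator is at most \<xi> ^ 4 * t, which cancels the singularity;
    for large \<xi> it is at most 1. A multiple of the arctangent density covers both
    regimes.\<close>
  have bnd: "\<bar>?f \<xi>\<bar> \<le> \<bar>(2 * t + 2) * (1 / (1 + \<xi>\<^sup>2))\<bar>" if "0 < \<xi>" for \<xi>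
  proof -
    have e: "0 \<le> 1 - exp (- (\<xi> ^ 4 * t))" "1 - exp (- (\<xi> ^ 4 * t)) \<le> 1"
      "1 - exp (- (\<xi> ^ 4 * t)) \<le> \<xi> ^ 4 * t"
      using exp_ge_add_one_self[of "- (\<xi> ^ 4 * t)"] assms by auto
    have "(1 - exp (- (\<xi> ^ 4 * t))) * (1 + \<xi>\<^sup>2) \<le> (2 * t + 2) * \<xi>\<^sup>2"
    proof (cases "\<xi> \<le> 1")
      case True
      then have "\<xi>\<^sup>2 \<le> 1" using that by (simp add: power_le_one)
      have "(1 - exp (- (\<xi> ^ 4 * t))) * (1 + \<xi>\<^sup>2) \<le> (\<xi> ^ 4 * t) * 2"
        using e \<open>\<xi>\<^sup>2 \<le> 1\<close> by (intro mult_mono) auto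
      also have "\<dots> = 2 * t * \<xi>\<^sup>2 * \<xi>\<^sup>2" by (simp add: power2_eq_square power4_eq_xxxx)
      also have "\<dots> \<le> 2 * t * \<xi>\<^sup>2 * 1"
        using \<open>\<xi>\<^sup>2 \<le> 1\<close> assms by (intro mult_left_mono) auto
      also have "\<dots> \<le> (2 * t + 2) * \<xi>\<^sup>2" by (simp add: algebra_simps)
      finally show ?thesis .
    next
      case False
      then have "1 \<le> \<xi>\<^sup>2" using that by (simp add: one_le_power)
      have "(1 - exp (- (\<xi> ^ 4 * t))) * (1 + \<xi>\<^sup>2) \<le> 1 * (1 + \<xi>\<^sup>2)"
        using e by (intro mult_right_mono) auto
      also have "\<dots> \<le> 2 * \<xi>\<^sup>2" using \<open>1 \<le> \<xi>\<^sup>2\<close> by simp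
      also have "\<dots> \<le> (2 * t + 2) * \<xi>\<^sup>2" using assms by (simp add: algebra_simps)
      finally show ?thesis .
    qed
    then have "?f \<xi> \<le> (2 * t + 2) * (1 / (1 + \<xi>\<^sup>2))"
      using that by (simp add: field_simps add_pos_nonneg)
    moreover have "0 \<le> ?f \<xi>" using e by simp
    ultimately show ?thesis by linarith
  qed
  show int: "set_integrable lborel {0<..} ?f"
  proof (rule set_integrable_bound)
    show "set_integrable lborel {0<..} (\<lambda>\<xi>. (2 * t + 2) * (1 / (1 + \<xi>\<^sup>2)))"
      using integrable_I0i_1_div_plus_square ei
      by (intro set_integrable_mult_right) (simp add: interval_lebesgue_integrable_def)
  qed (use bnd in \<open>auto simp: set_borel_measurable_def\<close>)
  have inth: "set_integrable lborel {0<..} ?h"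
    using quartic_moment(1)[OF assms, of 2] by (intro set_integrable_mult_right)
  have "(LBINT \<xi>=0..\<infinity>. ?f \<xi> - ?h \<xi>) = 0 - 0"
  proof (rule interval_integral_FTC_integrable[where F = ?F])
    show "(?F has_vector_derivative ?f x - ?h x) (at x)" if "0 < ereal x" for x
      unfolding has_real_derivative_iff_has_vector_derivative[symmetric] using that
      by (auto intro!: derivative_eq_intros simp: field_simps power2_eq_square power3_eq_cube power4_eq_xxxx zero_ereal_def)
    show "isCont (\<lambda>x. ?f x - ?h x) x" if "0 < ereal x" for x
      using that by (auto intro!: continuous_intros)
    show "set_integrable lborel (einterval 0 \<infinity>) (\<lambda>x. ?f x - ?h x)"
      using int inth ei by (simp add: set_integral_diff)
    have "(?F \<longlongrightarrow> 0) (at_right 0)" using assms by real_asymp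
    then show "((?F \<circ> real_of_ereal) \<longlongrightarrow> 0) (at_right 0)"
      unfolding zero_ereal_def ereal_tendsto_simps .
    have "(?F \<longlongrightarrow> 0) at_top" using assms by real_asymp
    then show "((?F \<circ> real_of_ereal) \<longlongrightarrow> 0) (at_left \<infinity>)"
      unfolding ereal_tendsto_simps .
  qed simp
  moreover have "(LBINT \<xi>=0..\<infinity>. ?f \<xi> - ?h \<xi>) = (LBINT \<xi>=0..\<infinity>. ?f \<xi>) - (LBINT \<xi>=0..\<infinity>. ?h \<xi>)"
    using int inth by (simp add: interval_lebesgue_integral_0_infty set_integral_diff)
  ultimately have "(LBINT \<xi>=0..\<infinity>. ?f \<xi>) = (LBINT \<xi>=0..\<infinity>. ?h \<xi>)" by simp
  also have "\<dots> = 4 * t * (Gamma (3 / 4) / 4 * t powr (- (3 / 4)))"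
    using quartic_moment(2)[OF assms, of 2] by (simp add: add.commute)
  also have "\<dots> = Gamma (3 / 4) * (t powr 1 * t powr (- (3 / 4)))"
    using assms by simp
  also have "t powr 1 * t powr (- (3 / 4)) = t powr (1 / 4)"
    unfolding powr_add[symmetric] by simp
  finally show "(LBINT \<xi>=0..\<infinity>. ?f \<xi>) = Gamma (3 / 4) * t powr (1 / 4)" .
qed

text \<open>The mean value inequality bounds each difference quotient by the majorant of the
  derivative, so dominated convergence applies along every sequence tending to x. Working within a
  convex S allows a majorant that is only locally uniform in the parameter.\<close>

lemma has_real_derivative_integral_dominated:
  fixes f f' :: "real \<Rightarrow> 'a \<Rightarrow> real"
  assumes "convex S" and "x \<in> S"
    and int: "\<And>y. y \<in> S \<Longrightarrow> integrable M (f y)"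
    and der: "\<And>y a. y \<in> S \<Longrightarrow> a \<in> space M \<Longrightarrow> ((\<lambda>z. f z a) has_real_derivative f' y a) (at y within S)"
    and bound: "\<And>y a. y \<in> S \<Longrightarrow> a \<in> space M \<Longrightarrow> \<bar>f' y a\<bar> \<le> g a"
    and g: "integrable M g"
    and meas: "f' x \<in> borel_measurable M"
  shows "((\<lambda>y. \<integral>a. f y a \<partial>M) has_real_derivative (\<integral>a. f' x a \<partial>M)) (at x within S)"
  unfolding has_field_derivative_iff tendsto_at_iff_sequentially
proof (intro allI impI)
  fix X :: "nat \<Rightarrow> real"
  assume X: "\<forall>i. X i \<in> S - {x}" "X \<longlonglongrightarrow> x"
  let ?q = "\<lambda>i a. (f (X i) a - f x a) / (X i - x)"
  have "(\<lambda>i. \<integral>a. ?q i a \<partial>M) \<longlonglongrightarrow> (\<integral>a. f' x a \<partial>M)"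
  proof (rule integral_dominated_convergence[OF meas _ g])
    show "?q i \<in> borel_measurable M" for i
      using X int[of "X i"] int[OF \<open>x \<in> S\<close>] by (auto simp: integrable_iff_bounded)
    show "AE a in M. (\<lambda>i. ?q i a) \<longlonglongrightarrow> f' x a"
    proof (rule AE_I2)
      fix a assume "a \<in> space M"
      then show "(\<lambda>i. ?q i a) \<longlonglongrightarrow> f' x a"
        using der[OF \<open>x \<in> S\<close>] X
        unfolding has_field_derivative_iff tendsto_at_iff_sequentially by (simp add: o_def)
    qed
    show "AE a in M. norm (?q i a) \<le> g a" for i
    proof (rule AE_I2)
      fix a assume a: "a \<in> space M"
      have "norm (f (X i) a - f x a) \<le> g a * norm (X i - x)"
        by (rule field_differentiable_bound[OF \<open>convex S\<close>, where f = "\<lambda>z. f z a" and f' = "\<lambda>y. f' y a"])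
           (use der bound a X \<open>x \<in> S\<close> in auto)
      then show "norm (?q i a) \<le> g a"
        using X by (simp add: field_simps)
    qed
  qed
  moreover have "(\<integral>a. ?q i a \<partial>M) = ((\<integral>a. f (X i) a \<partial>M) - (\<integral>a. f x a \<partial>M)) / (X i - x)" for i
    using X int[of "X i"] int[OF \<open>x \<in> S\<close>] by simp
  ultimately show "((\<lambda>y. ((\<integral>a. f y a \<partial>M) - (\<integral>a. f x a \<partial>M)) / (y - x)) \<circ> X) \<longlonglongrightarrow> (\<integral>a. f' x a \<partial>M)"
    by (simp only: o_def)
qed

text \<open>The scaling \<tau> = t * s reduces this to the unit interval. With a = 1 / 2, b = 3 / 4
  the power of t is 1 / 4, the growth of the main term; with a = b = 1 / 2 it disappears, which
  gives bounds uniform in time.\<close>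

lemma Beta_set_integral:
  fixes a b t :: real
  assumes "0 < a" "0 < b" "0 < t"
  shows "set_integrable lborel {0<..<t} (\<lambda>\<tau>. \<tau> powr (a - 1) * (t - \<tau>) powr (b - 1))"
    and "(LBINT \<tau>:{0<..<t}. \<tau> powr (a - 1) * (t - \<tau>) powr (b - 1)) = t powr (a + b - 1) * Beta a b"
proof -
  let ?f = "\<lambda>s::real. s powr (a - 1) * (1 - s) powr (b - 1)"
  let ?h = "\<lambda>\<tau>::real. \<tau> powr (a - 1) * (t - \<tau>) powr (b - 1)"
  have int: "set_integrable lborel {0<..<1} ?f"
    by (rule set_integrable_subset[OF integrable_Beta[OF assms(1,2)]]) auto
  have "(LBINT s:{0<..<1}. ?f s) = integral {0<..<1} ?f"
    by (rule set_borel_integral_eq_integral(2)[OF int])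
  also have "\<dots> = Beta a b"
    using has_integral_Beta_real[OF assms(1,2)]
    by (simp add: has_integral_Icc_iff_Ioo integral_unique)
  finally have base: "has_bochner_integral lborel (\<lambda>s. indicator {0<..<1} s *\<^sub>R ?f s) (Beta a b)"
    using int by (simp add: has_bochner_integral_iff set_integrable_def set_lebesgue_integral_def)
  have "indicator {0<..<t} (0 + t * s) *\<^sub>R ?h (0 + t * s)
        = t powr (a + b - 2) * (indicator {0<..<1} s *\<^sub>R ?f s)" for s
  proof (cases "0 < s \<and> s < 1")
    case True
    have "t - t * s = t * (1 - s)" by (simp add: algebra_simps)
    moreover have "t powr (a - 1) * t powr (b - 1) = t powr (a + b - 2)"
      by (simp add: powr_add[symmetric])
    ultimately show ?thesis using True assms by (simp add: powr_mult)
  next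
    case False
    then show ?thesis using assms by (auto simp: zero_less_mult_iff)
  qed
  moreover have "has_bochner_integral lborel (\<lambda>s. t powr (a + b - 2) * (indicator {0<..<1} s *\<^sub>R ?f s))
     (t powr (a + b - 2) * Beta a b)"
    using base by (rule has_bochner_integral_mult_right)
  moreover have "t powr (a + b - 2) * Beta a b = (t powr (a + b - 1) * Beta a b) /\<^sub>R \<bar>t\<bar>"
  proof -
    have "t powr (a + b - 1) = t powr (a + b - 2) * t powr 1"
      unfolding powr_add[symmetric] by simp
    then show ?thesis using assms by simp
  qed
  ultimately have "has_bochner_integral lborel (\<lambda>\<tau>. indicator {0<..<t} \<tau> *\<^sub>R ?h \<tau>) (t powr (a + b - 1) * Beta a b)"
    using assms by (subst lborel_has_bochner_integral_real_affine_iff[of t _ _ 0]) auto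
  then show "set_integrable lborel {0<..<t} ?h"
      "(LBINT \<tau>:{0<..<t}. ?h \<tau>) = t powr (a + b - 1) * Beta a b"
    by (auto simp: has_bochner_integral_iff set_integrable_def set_lebesgue_integral_def)
qed

section \<open>The Green function\<close>

text \<open>A non-integrable function has Bochner integral 0, so a pointwise majorant suffices in
  every case. Terms containing the nonlinearity can thus be estimated without discussing their
  measurability.\<close>

lemma abs_integral_le:
  fixes f g :: "'a \<Rightarrow> real"
  assumes g: "integrable M g" and le: "\<And>x. x \<in> space M \<Longrightarrow> \<bar>f x\<bar> \<le> g x"
  shows "\<bar>\<integral>x. f x \<partial>M\<bar> \<le> (\<integral>x. g x \<partial>M)"
proof (cases "integrable M f")
  case True
  have "\<bar>\<integral>x. f x \<partial>M\<bar> \<le> (\<integral>x. \<bar>f x\<bar> \<partial>M)" by (rule integral_abs_bound)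
  also have "\<dots> \<le> (\<integral>x. g x \<partial>M)"
    by (intro integral_mono integrable_abs True g le)
  finally show ?thesis .
next
  case False
  have "0 \<le> (\<integral>x. g x \<partial>M)"
    by (intro integral_nonneg_AE AE_I2) (use le in \<open>auto intro: order_trans[OF abs_ge_zero]\<close>)
  then show ?thesis using False by (simp add: not_integrable_integral_eq)
qed

lemma abs_set_integral_le:
  fixes f g :: "'a \<Rightarrow> real"
  assumes "set_integrable M A g" and "\<And>x. x \<in> A \<Longrightarrow> \<bar>f x\<bar> \<le> g x"
  shows "\<bar>LINT x:A|M. f x\<bar> \<le> (LINT x:A|M. g x)"
  unfolding set_lebesgue_integral_def
  by (rule abs_integral_le) (use assms in \<open>auto simp: set_integrable_def indicator_def\<close>)

lemma Green_has_derivative: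
  fixes t x :: real
  assumes "0 < t"
  shows "((\<lambda>z. Green z t) has_real_derivative
            - (1 / pi) * (LBINT \<xi>=0..\<infinity>. \<xi> * exp (- (\<xi> ^ 4 * t)) * sin (x * \<xi>))) (at x)"
proof -
  let ?f = "\<lambda>z \<xi>::real. indicator {0<..} \<xi> * (exp (- (\<xi> ^ 4 * t)) * cos (z * \<xi>))"
  let ?f' = "\<lambda>z \<xi>::real. indicator {0<..} \<xi> * (- (\<xi> * exp (- (\<xi> ^ 4 * t)) * sin (z * \<xi>)))"
  have m0: "set_integrable lborel {0<..} (\<lambda>\<xi>. exp (- (\<xi> ^ 4 * t)))"
    using quartic_moment(1)[OF assms, of 0] by simp
  have m1: "set_integrable lborel {0<..} (\<lambda>\<xi>. \<xi> * exp (- (\<xi> ^ 4 * t)))"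
    using quartic_moment(1)[OF assms, of 1] by simp
  have "((\<lambda>z. \<integral>\<xi>. ?f z \<xi> \<partial>lborel) has_real_derivative (\<integral>\<xi>. ?f' x \<xi> \<partial>lborel)) (at x within UNIV)"
  proof (rule has_real_derivative_integral_dominated)
    show "integrable lborel (?f y)" for y
      by (rule Bochner_Integration.integrable_bound[OF m0[unfolded set_integrable_def]])
         (auto simp: abs_mult indicator_def)
    show "integrable lborel (\<lambda>\<xi>. indicator {0<..} \<xi> *\<^sub>R (\<xi> * exp (- (\<xi> ^ 4 * t))))"
      using m1 by (simp add: set_integrable_def)
    show "\<bar>?f' y \<xi>\<bar> \<le> indicator {0<..} \<xi> *\<^sub>R (\<xi> * exp (- (\<xi> ^ 4 * t)))" for y \<xi>
      using mult_left_mono[OF abs_sin_le_one[of "y * \<xi>"], of "\<bar>\<xi>\<bar> * exp (- (\<xi> ^ 4 * t))"]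
      by (auto simp: abs_mult indicator_def)
    show "((\<lambda>z. ?f z \<xi>) has_real_derivative ?f' y \<xi>) (at y within UNIV)" for y \<xi>
      by (auto intro!: derivative_eq_intros)
  qed auto
  from DERIV_cmult[OF this, of "1 / pi"] show ?thesis
    by (simp add: Green_def interval_lebesgue_integral_0_infty set_lebesgue_integral_def)
qed

lemma Green_x_eq:
  assumes "0 < t"
  shows "Green_x x t = - (1 / pi) * (LBINT \<xi>=0..\<infinity>. \<xi> * exp (- (\<xi> ^ 4 * t)) * sin (x * \<xi>))"
  unfolding Green_x_def by (rule DERIV_imp_deriv[OF Green_has_derivative[OF assms]])

lemma abs_sine_moment_le:
  fixes t x :: real
  assumes "0 < t"
  shows "\<bar>LBINT \<xi>=0..\<infinity>. \<xi> * exp (- (\<xi> ^ 4 * t)) * sin (x * \<xi>)\<bar> \<le> sqrt pi / 4 * t powr (- 1 / 2)"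
proof -
  have "\<bar>LBINT \<xi>:{0<..}. \<xi> * exp (- (\<xi> ^ 4 * t)) * sin (x * \<xi>)\<bar> \<le> (LBINT \<xi>:{0<..}. \<xi> ^ 1 * exp (- (\<xi> ^ 4 * t)))"
  proof (rule abs_set_integral_le[OF quartic_moment(1)[OF assms, of 1]])
    show "\<bar>\<xi> * exp (- (\<xi> ^ 4 * t)) * sin (x * \<xi>)\<bar> \<le> \<xi> ^ 1 * exp (- (\<xi> ^ 4 * t))" if "\<xi> \<in> {0<..}" for \<xi>
      using mult_left_mono[OF abs_sin_le_one[of "x * \<xi>"], of "\<bar>\<xi>\<bar> * exp (- (\<xi> ^ 4 * t))"] that
      by (auto simp: abs_mult)
  qed
  also have "\<dots> = Gamma (1 / 2) / 4 * t powr (- 1 / 2)"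
    using quartic_moment(2)[OF assms, of 1] by (simp add: interval_lebesgue_integral_0_infty)
  finally show ?thesis by (simp add: interval_lebesgue_integral_0_infty Gamma_one_half_real)
qed

text \<open>Two integrations by parts in \<open>\<xi>\<close> at once: for \<open>\<phi> \<xi> = \<xi> * exp (- (\<xi> ^ 4 * t))\<close> the function
  \<open>\<phi>' \<xi> * sin (x * \<xi>) - x * \<phi> \<xi> * cos (x * \<xi>)\<close> is a primitive of \<open>(\<phi>'' \<xi> + x\<^sup>2 * \<phi> \<xi>) * sin (x * \<xi>)\<close>.\<close>

lemma abs_sine_moment_decay:
  fixes t x :: real
  assumes "0 < t"
  shows "x\<^sup>2 * \<bar>LBINT \<xi>=0..\<infinity>. \<xi> * exp (- (\<xi> ^ 4 * t)) * sin (x * \<xi>)\<bar> \<le> 9"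
proof -
  let ?e = "\<lambda>\<xi>::real. exp (- (\<xi> ^ 4 * t))"
  let ?p = "\<lambda>\<xi>. \<xi> * ?e \<xi> * sin (x * \<xi>)"
  let ?q = "\<lambda>\<xi>. (16 * t\<^sup>2 * \<xi> ^ 7 - 20 * t * \<xi> ^ 3) * ?e \<xi> * sin (x * \<xi>)"
  let ?g = "\<lambda>\<xi>. 16 * t\<^sup>2 * (\<xi> ^ 7 * ?e \<xi>) + 20 * t * (\<xi> ^ 3 * ?e \<xi>)"
  let ?F = "\<lambda>\<xi>. (1 - 4 * t * \<xi> ^ 4) * ?e \<xi> * sin (x * \<xi>) - x * (\<xi> * ?e \<xi>) * cos (x * \<xi>)"
  have ei: "einterval 0 \<infinity> = {0<..}" by (simp add: zero_ereal_def)
  note m = quartic_moment(1)[OF assms]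
  have intg: "set_integrable lborel {0<..} ?g"
    by (intro set_integral_add set_integrable_mult_right m)
  have qg: "\<bar>?q \<xi>\<bar> \<le> ?g \<xi>" if "0 < \<xi>" for \<xi>
  proof -
    have "\<bar>?q \<xi>\<bar> \<le> \<bar>(16 * t\<^sup>2 * \<xi> ^ 7 - 20 * t * \<xi> ^ 3) * ?e \<xi>\<bar>"
      using mult_left_mono[OF abs_sin_le_one[of "x * \<xi>"], of "\<bar>(16 * t\<^sup>2 * \<xi> ^ 7 - 20 * t * \<xi> ^ 3) * ?e \<xi>\<bar>"]
      by (auto simp: abs_mult)
    also have "\<dots> = \<bar>16 * t\<^sup>2 * \<xi> ^ 7 - 20 * t * \<xi> ^ 3\<bar> * ?e \<xi>" by (simp add: abs_mult)
    also have "\<dots> \<le> (16 * t\<^sup>2 * \<xi> ^ 7 + 20 * t * \<xi> ^ 3) * ?e \<xi>"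
      using that assms by (intro mult_right_mono) (auto simp: abs_le_iff)
    finally show ?thesis by (simp add: algebra_simps)
  qed
  have intq: "set_integrable lborel {0<..} ?q"
    by (rule set_integrable_bound[OF intg])
       (use qg in \<open>auto simp: set_borel_measurable_def intro: order_trans[OF _ abs_ge_self]\<close>)
  have intp: "set_integrable lborel {0<..} ?p"
    by (rule set_integrable_bound[OF m[of 1]])
       (auto simp: set_borel_measurable_def abs_mult)
  have "(LBINT \<xi>=0..\<infinity>. ?q \<xi> + x\<^sup>2 * ?p \<xi>) = 0 - 0"
  proof (rule interval_integral_FTC_integrable[where F = ?F])
    show "(?F has_vector_derivative ?q \<xi> + x\<^sup>2 * ?p \<xi>) (at \<xi>)" for \<xi>
      unfolding has_real_derivative_iff_has_vector_derivative[symmetric]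
      by (rule derivative_eq_intros refl | simp)+
         (simp add: algebra_simps power2_eq_square power3_eq_cube power_numeral_reduce)
    show "isCont (\<lambda>\<xi>. ?q \<xi> + x\<^sup>2 * ?p \<xi>) \<xi>" for \<xi>
      by (auto intro!: continuous_intros)
    show "set_integrable lborel (einterval 0 \<infinity>) (\<lambda>\<xi>. ?q \<xi> + x\<^sup>2 * ?p \<xi>)"
      unfolding ei by (intro set_integral_add set_integrable_mult_right intq intp)
    have "isCont ?F 0" by (auto intro!: continuous_intros)
    then have "(?F \<longlongrightarrow> 0) (at_right 0)"
      by (auto simp: isCont_def intro: tendsto_within_subset)
    then show "((?F \<circ> real_of_ereal) \<longlongrightarrow> 0) (at_right 0)"
      unfolding zero_ereal_def ereal_tendsto_simps .
    have "((\<lambda>\<xi>. (1 - 4 * t * \<xi> ^ 4) * ?e \<xi>) \<longlongrightarrow> 0) at_top" "((\<lambda>\<xi>. x * (\<xi> * ?e \<xi>)) \<longlongrightarrow> 0) at_top"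
      using assms by real_asymp+
    then have "((\<lambda>\<xi>. (1 - 4 * t * \<xi> ^ 4) * ?e \<xi> * sin (x * \<xi>)) \<longlongrightarrow> 0) at_top"
      "((\<lambda>\<xi>. x * (\<xi> * ?e \<xi>) * cos (x * \<xi>)) \<longlongrightarrow> 0) at_top"
      by (auto intro!: lim_null_mult_right_bounded[where B = 1])
    then have "(?F \<longlongrightarrow> 0 - 0) at_top" by (rule tendsto_diff)
    then show "((?F \<circ> real_of_ereal) \<longlongrightarrow> 0) (at_left \<infinity>)"
      unfolding ereal_tendsto_simps by simp
  qed simp
  moreover have "(LBINT \<xi>=0..\<infinity>. ?q \<xi> + x\<^sup>2 * ?p \<xi>) = (LBINT \<xi>:{0<..}. ?q \<xi>) + x\<^sup>2 * (LBINT \<xi>:{0<..}. ?p \<xi>)"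
    unfolding interval_lebesgue_integral_0_infty
    by (subst set_integral_add(2)) (use intq intp in \<open>auto intro: set_integrable_mult_right\<close>)
  ultimately have sum0: "(LBINT \<xi>:{0<..}. ?q \<xi>) + x\<^sup>2 * (LBINT \<xi>:{0<..}. ?p \<xi>) = 0" by simp
  have "b + x\<^sup>2 * a = 0 \<Longrightarrow> x\<^sup>2 * \<bar>a\<bar> = \<bar>b\<bar>" for a b :: real
    by (metis abs_minus_cancel abs_mult abs_power2 add_eq_0_iff)
  from this[OF sum0] have "x\<^sup>2 * \<bar>LBINT \<xi>:{0<..}. ?p \<xi>\<bar> = \<bar>LBINT \<xi>:{0<..}. ?q \<xi>\<bar>" .
  also have "\<dots> \<le> (LBINT \<xi>:{0<..}. ?g \<xi>)"
    by (rule abs_set_integral_le[OF intg]) (use qg in auto)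
  also have "\<dots> = 16 * t\<^sup>2 * (LBINT \<xi>:{0<..}. \<xi> ^ 7 * ?e \<xi>) + 20 * t * (LBINT \<xi>:{0<..}. \<xi> ^ 3 * ?e \<xi>)"
    using m by (simp add: set_integral_add)
  \<comment> \<open>The moments have the values Gamma 2 / 4 and Gamma 1 / 4 times powers of t that
    cancel the prefactors, so the bound is 16 / 4 + 20 / 4 = 9 for every t.\<close>
  also have "(LBINT \<xi>:{0<..}. \<xi> ^ 7 * ?e \<xi>) = 1 / 4 * t powr (- 2)"
    using quartic_moment(2)[OF assms, of 7] Gamma_fact[of 1, where 'a = real]
    by (simp add: interval_lebesgue_integral_0_infty)
  also have "(LBINT \<xi>:{0<..}. \<xi> ^ 3 * ?e \<xi>) = 1 / 4 * t powr (- 1)"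
    using quartic_moment(2)[OF assms, of 3] Gamma_fact[of 0, where 'a = real]
    by (simp add: interval_lebesgue_integral_0_infty)
  also have "16 * t\<^sup>2 * (1 / 4 * t powr - 2) + 20 * t * (1 / 4 * t powr - 1) = 9"
    using assms by (simp add: powr_minus powr_numeral field_simps power2_eq_square)
  finally show ?thesis by (simp add: interval_lebesgue_integral_0_infty)
qed

text \<open>The size estimate weighted by sqrt t and the decay estimate weighted by
  \<open>x\<^sup>2\<close> are added: sqrt pi / 4 + 9 is at most 12, hence at most 4 * pi. The
  resulting majorant is integrable in space.\<close>

lemma Green_x_bound:
  assumes "0 < t"
  shows "\<bar>Green_x x t\<bar> \<le> 4 / (sqrt t + x\<^sup>2)"
proof -
  define I where "I = (LBINT \<xi>=0..\<infinity>. \<xi> * exp (- (\<xi> ^ 4 * t)) * sin (x * \<xi>))"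
  have "t powr (- 1 / 2) = 1 / sqrt t"
    using assms by (simp add: powr_half_sqrt powr_minus_divide)
  then have "sqrt t * \<bar>I\<bar> \<le> sqrt pi / 4"
    using abs_sine_moment_le[OF assms, of x, folded I_def, unfolded \<open>t powr (- 1 / 2) = 1 / sqrt t\<close>] assms
    by (simp add: field_simps)
  moreover have "sqrt pi \<le> 2" using pi_less_4 by (intro real_le_lsqrt) auto
  moreover have "x\<^sup>2 * \<bar>I\<bar> \<le> 9"
    using abs_sine_moment_decay[OF assms, of x] by (simp add: I_def)
  ultimately have "(sqrt t + x\<^sup>2) * \<bar>I\<bar> \<le> 4 * 3" by (simp add: algebra_simps)
  also have "\<dots> \<le> 4 * pi" using pi_gt3 by simp
  finally have "\<bar>I\<bar> / pi \<le> 4 / (sqrt t + x\<^sup>2)"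
    using assms by (simp add: field_simps add_pos_nonneg)
  then show ?thesis by (simp add: Green_x_eq[OF assms] I_def abs_mult)
qed

text \<open>Rescaling by t powr (1 / 4) reduces the majorant to the arctangent density. The spatial
  L1 norm of the differentiated kernel is therefore O(t powr (- 1 / 4)), a singularity that is
  integrable in time.\<close>

lemma Green_x_bound_integral:
  fixes t :: real
  assumes "0 < t"
  shows "has_bochner_integral lborel (\<lambda>y. 4 / (sqrt t + y\<^sup>2)) (4 * pi * t powr (- 1 / 4))"
proof -
  define c where "c = t powr (1 / 4)"
  have c: "0 < c" "sqrt t = c\<^sup>2" "t powr (- 1 / 4) = 1 / c"
    using assms by (auto simp: c_def powr_half_sqrt[symmetric] power2_eq_square powr_add[symmetric] powr_minus_divide)
  have "has_bochner_integral lborel (\<lambda>y::real. inverse (1 + y\<^sup>2)) pi"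
    using integrable_inverse_1_plus_square LBINT_inverse_1_plus_square
    by (simp add: has_bochner_integral_iff interval_lebesgue_integral_def set_integrable_def set_lebesgue_integral_def)
  then have "has_bochner_integral lborel (\<lambda>y::real. 4 / c\<^sup>2 * inverse (1 + y\<^sup>2)) (4 / c\<^sup>2 * pi)"
    by (rule has_bochner_integral_mult_right)
  moreover have "4 / c\<^sup>2 * inverse (1 + y\<^sup>2) = 4 / (sqrt t + (0 + c * y)\<^sup>2)" for y
    using c by (simp add: field_simps power_mult_distrib)
  moreover have "4 / c\<^sup>2 * pi = (4 * pi * t powr (- 1 / 4)) /\<^sub>R \<bar>c\<bar>"
    using c by (simp add: field_simps power2_eq_square)
  ultimately show ?thesis
    using c(1) by (subst lborel_has_bochner_integral_real_affine_iff[of c _ _ 0]) auto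
qed

section \<open>Interpolation on the half-line\<close>

lemma mvt_half_line:
  fixes u u1 :: "real \<Rightarrow> real"
  assumes "\<And>x. 0 \<le> x \<Longrightarrow> (u has_real_derivative u1 x) (at x within {0..})" and "0 \<le> a" "a \<le> b"
  obtains z where "a \<le> z" "z \<le> b" "u b - u a = u1 z * (b - a)"
proof -
  have "\<exists>z\<in>{a..b}. u b - u a = (\<lambda>v. u1 z * v) (b - a)"
  proof (rule mvt_very_simple[OF \<open>a \<le> b\<close>])
    fix x assume "a \<le> x" "x \<le> b"
    then show "(u has_derivative (\<lambda>v. u1 x * v)) (at x within {a..b})"
      using assms(1)[of x] assms(2) unfolding has_field_derivative_def
      by (auto elim!: has_derivative_subset)
  qed
  then show ?thesis using that by auto
qed

text \<open>Two applications of the mean value theorem write the second difference of u with step h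
  as \<open>u2 v * h\<^sup>2\<close> for some v within 2 * h of x; the Hoelder condition moves v
  back to x. All nodes lie to the right of x, so the boundary point needs no separate treatment. The
  factor 4 counts the three nodes with the middle one twice.\<close>

lemma half_line_interpolation:
  fixes u u1 u2 :: "real \<Rightarrow> real"
  assumes d1: "\<And>x. 0 \<le> x \<Longrightarrow> (u has_real_derivative u1 x) (at x within {0..})"
    and d2: "\<And>x. 0 \<le> x \<Longrightarrow> (u1 has_real_derivative u2 x) (at x within {0..})"
    and A: "\<And>x. 0 \<le> x \<Longrightarrow> \<bar>u x\<bar> \<le> A"
    and H: "\<And>x y. 0 \<le> x \<Longrightarrow> 0 \<le> y \<Longrightarrow> \<bar>u2 x - u2 y\<bar> \<le> H * \<bar>x - y\<bar> powr \<gamma>"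
    and "0 < \<gamma>" "0 < h" "0 \<le> x"
  shows "\<bar>u2 x\<bar> \<le> 4 * A / h\<^sup>2 + H * (2 * h) powr \<gamma>"
    and "\<bar>u1 x\<bar> \<le> 6 * A / h + h * (H * (2 * h) powr \<gamma>)"
proof -
  have "0 \<le> H" using H[of 0 1] by simp
  have sec: "\<bar>u2 x\<bar> \<le> 4 * A / h\<^sup>2 + H * (2 * h) powr \<gamma>" if "0 \<le> x" for x
  proof -
    have "((\<lambda>s. u (s + h) - u s) has_real_derivative u1 (s + h) - u1 s) (at s within {0..})" if "0 \<le> s" for s
    proof -
      have "(\<lambda>s. s + h) ` {0..} \<subseteq> {0..}" using \<open>0 < h\<close> by auto
      then have "(u has_real_derivative u1 (s + h)) (at (s + h) within (\<lambda>s. s + h) ` {0..})"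
        using d1[of "s + h"] that \<open>0 < h\<close> by (auto intro: DERIV_subset)
      then have "(u \<circ> (\<lambda>s. s + h) has_real_derivative u1 (s + h) * 1) (at s within {0..})"
        by (rule DERIV_image_chain) (auto intro!: derivative_eq_intros)
      then show ?thesis using d1[OF that] by (auto simp: o_def intro: DERIV_diff)
    qed
    from mvt_half_line[OF this, of x "x + h"] that \<open>0 < h\<close>
    obtain z where z: "x \<le> z" "z \<le> x + h"
      "u (x + h + h) - u (x + h) - (u (x + h) - u x) = (u1 (z + h) - u1 z) * h" by auto
    from mvt_half_line[OF d2, of z "z + h"] z that \<open>0 < h\<close>
    obtain v where v: "z \<le> v" "v \<le> z + h" "u1 (z + h) - u1 z = u2 v * h" by auto
    have "u2 v * h\<^sup>2 = u (x + h + h) - u (x + h) - (u (x + h) - u x)"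
      unfolding z(3) v(3) by (simp add: power2_eq_square)
    moreover have "\<bar>u (x + h + h)\<bar> \<le> A" "\<bar>u (x + h)\<bar> \<le> A" "\<bar>u x\<bar> \<le> A"
      using that \<open>0 < h\<close> by (auto intro!: A)
    ultimately have "\<bar>u2 v * h\<^sup>2\<bar> \<le> 4 * A" by linarith
    then have "\<bar>u2 v\<bar> * h\<^sup>2 \<le> 4 * A" by (simp add: abs_mult)
    then have "\<bar>u2 v\<bar> \<le> 4 * A / h\<^sup>2" using \<open>0 < h\<close> by (simp add: field_simps)
    moreover have "\<bar>u2 x - u2 v\<bar> \<le> H * (2 * h) powr \<gamma>"
    proof -
      have "\<bar>x - v\<bar> powr \<gamma> \<le> (2 * h) powr \<gamma>"
        using z v \<open>0 < \<gamma>\<close> by (intro powr_mono2) auto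
      then have "H * \<bar>x - v\<bar> powr \<gamma> \<le> H * (2 * h) powr \<gamma>"
        using \<open>0 \<le> H\<close> by (rule mult_left_mono)
      moreover have "\<bar>u2 x - u2 v\<bar> \<le> H * \<bar>x - v\<bar> powr \<gamma>"
        using z v that by (intro H) auto
      ultimately show ?thesis by linarith
    qed
    ultimately show ?thesis by linarith
  qed
  then show "\<bar>u2 x\<bar> \<le> 4 * A / h\<^sup>2 + H * (2 * h) powr \<gamma>" using \<open>0 \<le> x\<close> .
  \<comment> \<open>A first difference controls u1 at some z near x by 2 * A / h. The change of u1
    from z to x costs h times the bound on u2 just obtained, which adds 4 * A / h and explains the
    factor 6.\<close>
  obtain z where z: "x \<le> z" "z \<le> x + h" "u (x + h) - u x = u1 z * h"
    using mvt_half_line[OF d1, of x "x + h"] \<open>0 \<le> x\<close> \<open>0 < h\<close> by auto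
  have "\<bar>u1 z\<bar> * h = \<bar>u (x + h) - u x\<bar>" using z \<open>0 < h\<close> by (simp add: abs_mult)
  also have "\<dots> \<le> 2 * A" using A[of "x + h"] A[of x] \<open>0 \<le> x\<close> \<open>0 < h\<close> by linarith
  finally have 1: "\<bar>u1 z\<bar> \<le> 2 * A / h" using \<open>0 < h\<close> by (simp add: field_simps)
  obtain v where v: "x \<le> v" "v \<le> z" "u1 z - u1 x = u2 v * (z - x)"
    using mvt_half_line[OF d2, of x z] \<open>0 \<le> x\<close> z by auto
  have "\<bar>u1 z - u1 x\<bar> = \<bar>u2 v\<bar> * (z - x)" using v by (simp add: abs_mult)
  also have "\<dots> \<le> (4 * A / h\<^sup>2 + H * (2 * h) powr \<gamma>) * h"
    using sec[of v] v z \<open>0 \<le> x\<close> by (intro mult_mono) auto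
  also have "\<dots> = 4 * A / h + h * (H * (2 * h) powr \<gamma>)"
    using \<open>0 < h\<close> by (simp add: field_simps power2_eq_square)
  finally have "\<bar>u1 z - u1 x\<bar> \<le> 4 * A / h + h * (H * (2 * h) powr \<gamma>)" .
  moreover have "6 * A / h = 2 * A / h + 4 * A / h" by (simp add: add_divide_distrib[symmetric])
  ultimately show "\<bar>u1 x\<bar> \<le> 6 * A / h + h * (H * (2 * h) powr \<gamma>)"
    using 1 by linarith
qed

section \<open>The boundary part\<close>

lemma Si_0 [simp]: "Si 0 = 0"
  by (simp add: Si_def zero_ereal_def[symmetric])

text \<open>For x > 0, integration by parts gives the primitive x * Si (x * \<xi>) - (1 - cos (x *
  \<xi>)) / \<xi>, and only the limit pi / 2 of the sine integral survives. Since the integrand is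
  nonnegative, the fundamental theorem also yields integrability. Evenness in x covers the other
  sign.\<close>

lemma one_minus_cos_integral:
  fixes x :: real
  shows "set_integrable lborel {0<..} (\<lambda>\<xi>. (1 - cos (x * \<xi>)) / \<xi>\<^sup>2)" (is "set_integrable _ _ (?f x)")
    and "(LBINT \<xi>=0..\<infinity>. (1 - cos (x * \<xi>)) / \<xi>\<^sup>2) = pi / 2 * \<bar>x\<bar>"
proof -
  have ei: "einterval 0 \<infinity> = {0<..}" by (simp add: zero_ereal_def)
  have pos: "set_integrable lborel {0<..} (?f x) \<and> (LBINT \<xi>=0..\<infinity>. ?f x \<xi>) = pi / 2 * x" if "0 < x" for x
  proof -
    let ?F = "\<lambda>\<xi>. x * Si (x * \<xi>) - (1 - cos (x * \<xi>)) / \<xi>"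
    have deriv: "(?F has_real_derivative ?f x \<xi>) (at \<xi>)" if "0 < ereal \<xi>" for \<xi>
    proof -
      have "0 < \<xi>" using that by (simp add: zero_ereal_def)
      have "((\<lambda>\<xi>. Si (x * \<xi>)) has_real_derivative sinc (x * \<xi>) * x) (at \<xi>)"
        by (rule DERIV_chain2[OF DERIV_Si]) (auto intro!: derivative_eq_intros)
      then have "(?F has_real_derivative x * (sinc (x * \<xi>) * x)
          - ((x * sin (x * \<xi>)) * \<xi> - (1 - cos (x * \<xi>)) * 1) / (\<xi> * \<xi>)) (at \<xi>)"
        using \<open>0 < \<xi>\<close> by (auto intro!: derivative_eq_intros simp: mult.commute)
      moreover have "x * (sinc (x * \<xi>) * x)
          - ((x * sin (x * \<xi>)) * \<xi> - (1 - cos (x * \<xi>)) * 1) / (\<xi> * \<xi>) = ?f x \<xi>"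
        using \<open>0 < \<xi>\<close> \<open>0 < x\<close> by (simp add: field_simps power2_eq_square)
      ultimately show ?thesis by simp
    qed
    have cont: "isCont (?f x) \<xi>" if "0 < ereal \<xi>" for \<xi>
      using that by (auto intro!: continuous_intros simp: zero_ereal_def)
    have "((\<lambda>\<xi>. Si (x * \<xi>)) \<longlongrightarrow> Si (x * 0)) (at_right 0)"
      by (intro isCont_tendsto_compose[OF isCont_Si] tendsto_intros)
    then have "((\<lambda>\<xi>. x * Si (x * \<xi>)) \<longlongrightarrow> 0) (at_right 0)"
      using tendsto_mult[OF tendsto_const[of x]] by fastforce
    moreover have "((\<lambda>\<xi>. (1 - cos (x * \<xi>)) / \<xi>) \<longlongrightarrow> 0) (at_right 0)"
      by real_asymp
    ultimately have "(?F \<longlongrightarrow> 0) (at_right 0)"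
      using tendsto_diff by fastforce
    then have lim0: "((?F \<circ> real_of_ereal) \<longlongrightarrow> 0) (at_right 0)"
      unfolding zero_ereal_def ereal_tendsto_simps .
    have "filterlim (\<lambda>\<xi>. x * \<xi>) at_top at_top" using \<open>0 < x\<close> by real_asymp
    then have "((\<lambda>\<xi>. x * Si (x * \<xi>)) \<longlongrightarrow> x * (pi / 2)) at_top"
      by (intro tendsto_mult tendsto_const filterlim_compose[OF Si_at_top])
    moreover have "((\<lambda>\<xi>. (1 - cos (x * \<xi>)) / \<xi>) \<longlongrightarrow> 0) at_top"
    proof (rule tendsto_0_le[where K = 1])
      show "((\<lambda>\<xi>::real. 2 / \<xi>) \<longlongrightarrow> 0) at_top" by real_asymp
      show "\<forall>\<^sub>F \<xi> in at_top. norm ((1 - cos (x * \<xi>)) / \<xi>) \<le> norm (2 / \<xi>) * 1"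
      proof (intro always_eventually allI)
        fix \<xi>
        have "\<bar>1 - cos (x * \<xi>)\<bar> \<le> 2" using cos_ge_minus_one[of "x * \<xi>"] cos_le_one[of "x * \<xi>"] by linarith
        then show "norm ((1 - cos (x * \<xi>)) / \<xi>) \<le> norm (2 / \<xi>) * 1"
          by (simp add: divide_right_mono)
      qed
    qed
    ultimately have "(?F \<longlongrightarrow> x * (pi / 2) - 0) at_top"
      by (rule tendsto_diff)
    then have lim1: "((?F \<circ> real_of_ereal) \<longlongrightarrow> pi / 2 * x) (at_left \<infinity>)"
      unfolding ereal_tendsto_simps by (simp add: mult.commute)
    have nonneg: "AE \<xi> in lborel. 0 < ereal \<xi> \<longrightarrow> ereal \<xi> < \<infinity> \<longrightarrow> 0 \<le> ?f x \<xi>" by simp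
    show ?thesis
      using interval_integral_FTC_nonneg[OF _ deriv cont nonneg lim0 lim1] by (simp add: ei)
  qed
  have eq: "?f x = ?f \<bar>x\<bar>" by (auto simp: abs_if)
  show "set_integrable lborel {0<..} (?f x)"
    using pos[of "\<bar>x\<bar>"] unfolding eq by (cases "x = 0") (auto simp: set_integrable_def)
  show "(LBINT \<xi>=0..\<infinity>. ?f x \<xi>) = pi / 2 * \<bar>x\<bar>"
    using pos[of "\<bar>x\<bar>"] unfolding eq by (cases "x = 0") auto
qed

lemma smoothed_cos_integral_has_derivative:
  fixes t x :: real
  assumes "0 < t"
  shows "set_integrable lborel {0<..} (\<lambda>\<xi>. exp (- (\<xi> ^ 4 * t)) * ((1 - cos (x * \<xi>)) / \<xi>\<^sup>2))" (is "set_integrable _ _ (?f x)")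
    and "((\<lambda>z. LBINT \<xi>=0..\<infinity>. exp (- (\<xi> ^ 4 * t)) * ((1 - cos (z * \<xi>)) / \<xi>\<^sup>2)) has_real_derivative
           (LBINT \<xi>=0..\<infinity>. exp (- (\<xi> ^ 4 * t)) * (sin (x * \<xi>) / \<xi>))) (at x)"
proof -
  let ?e = "\<lambda>\<xi>::real. exp (- (\<xi> ^ 4 * t))"
  have int: "set_integrable lborel {0<..} (?f y)" for y
  proof (rule set_integrable_bound[OF one_minus_cos_integral(1)[of y]])
    show "set_borel_measurable lborel {0<..} (?f y)" by (simp add: set_borel_measurable_def)
    have "?e \<xi> * \<bar>(1 - cos (y * \<xi>)) / \<xi>\<^sup>2\<bar> \<le> 1 * \<bar>(1 - cos (y * \<xi>)) / \<xi>\<^sup>2\<bar>" for \<xi>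
      using assms by (intro mult_right_mono) auto
    then show "AE \<xi> in lborel. \<xi> \<in> {0<..} \<longrightarrow> norm (?f y \<xi>) \<le> norm ((1 - cos (y * \<xi>)) / \<xi>\<^sup>2)"
      by (simp add: abs_mult)
  qed
  show "set_integrable lborel {0<..} (?f x)" by (rule int)
  \<comment> \<open>The majorant rests on \<bar>sin (z * \<xi>) / \<xi>\<bar> \<le> \<bar>z\<bar>,
    which is uniform only for bounded z; hence the differentiation takes place on an interval around
    x.\<close>
  define R where "R = \<bar>x\<bar> + 1"
  let ?F = "\<lambda>z \<xi>::real. indicator {0<..} \<xi> *\<^sub>R ?f z \<xi>"
  let ?F' = "\<lambda>z \<xi>::real. indicator {0<..} \<xi> *\<^sub>R (?e \<xi> * (sin (z * \<xi>) / \<xi>))"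
  have "((\<lambda>z. \<integral>\<xi>. ?F z \<xi> \<partial>lborel) has_real_derivative (\<integral>\<xi>. ?F' x \<xi> \<partial>lborel)) (at x within {-R<..<R})"
  proof (rule has_real_derivative_integral_dominated)
    show "integrable lborel (?F y)" for y using int[of y] by (simp add: set_integrable_def)
    show "integrable lborel (\<lambda>\<xi>. R * (indicator {0<..} \<xi> *\<^sub>R ?e \<xi>))"
      using quartic_moment(1)[OF assms, of 0] by (simp add: set_integrable_def)
    show "\<bar>?F' y \<xi>\<bar> \<le> R * (indicator {0<..} \<xi> *\<^sub>R ?e \<xi>)" if "y \<in> {-R<..<R}" for y \<xi>
    proof (cases "0 < \<xi>")
      case True
      have "\<bar>sin (y * \<xi>)\<bar> \<le> \<bar>y\<bar> * \<xi>" using abs_sin_x_le_abs_x[of "y * \<xi>"] True by (simp add: abs_mult)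
      also have "\<dots> \<le> R * \<xi>" using that True by (intro mult_right_mono) auto
      finally have "\<bar>sin (y * \<xi>) / \<xi>\<bar> \<le> R" using True by (simp add: field_simps)
      from mult_right_mono[OF this, of "?e \<xi>"] show ?thesis
        using True by (simp add: abs_mult mult.commute)
    qed simp
    show "((\<lambda>z. ?F z \<xi>) has_real_derivative ?F' y \<xi>) (at y within {-R<..<R})" for y \<xi>
      by (cases "0 < \<xi>") (auto intro!: derivative_eq_intros simp: field_simps power2_eq_square)
  qed (auto simp: R_def)
  moreover have "at x within {-R<..<R} = at x"
    by (rule at_within_open) (auto simp: R_def)
  ultimately show "((\<lambda>z. LBINT \<xi>=0..\<infinity>. ?f z \<xi>) has_real_derivative
           (LBINT \<xi>=0..\<infinity>. ?e \<xi> * (sin (x * \<xi>) / \<xi>))) (at x)"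
    by (simp add: interval_lebesgue_integral_0_infty set_lebesgue_integral_def)
qed

text \<open>After integration by parts, Si (x * \<xi>) is averaged against the weight
  \<open>4 * t * \<xi> ^ 3 * exp (- (\<xi> ^ 4 * t))\<close>, a probability density on the
  half-line. The integral thus inherits the bound of Si, uniformly in x and t.\<close>

lemma abs_smoothed_Dirichlet_integral_le:
  fixes t x S :: real
  assumes "0 < t" and S: "\<And>y. \<bar>Si y\<bar> \<le> S"
  shows "\<bar>LBINT \<xi>=0..\<infinity>. exp (- (\<xi> ^ 4 * t)) * (sin (x * \<xi>) / \<xi>)\<bar> \<le> S"
proof -
  let ?e = "\<lambda>\<xi>::real. exp (- (\<xi> ^ 4 * t))"
  \<comment> \<open>This is the integrand sin (x * \<xi>) / \<xi> with its continuous value x at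
    \<xi> = 0.\<close>
  let ?p = "\<lambda>\<xi>. ?e \<xi> * (x * sinc (x * \<xi>))"
  let ?q = "\<lambda>\<xi>. 4 * t * (\<xi> ^ 3 * ?e \<xi>) * Si (x * \<xi>)"
  let ?g = "\<lambda>\<xi>. S * (4 * t) * (\<xi> ^ 3 * ?e \<xi>)"
  have ei: "einterval 0 \<infinity> = {0<..}" by (simp add: zero_ereal_def)
  have pe: "?p \<xi> = ?e \<xi> * (sin (x * \<xi>) / \<xi>)" if "0 < \<xi>" for \<xi> using that by simp
  have intp: "set_integrable lborel {0<..} ?p"
  proof (rule set_integrable_bound)
    show "set_integrable lborel {0<..} (\<lambda>\<xi>. x * (\<xi> ^ 0 * ?e \<xi>))"
      using quartic_moment(1)[OF assms(1), of 0] by (intro set_integrable_mult_right)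
    show "set_borel_measurable lborel {0<..} ?p" by (simp add: set_borel_measurable_def)
    have sinc1: "\<bar>sinc y\<bar> \<le> 1" for y :: real
      using abs_sin_x_le_abs_x[of y] by (simp add: field_simps)
    have xc: "\<bar>x * c\<bar> \<le> \<bar>x\<bar>" if "\<bar>c\<bar> \<le> 1" for c
      using mult_left_mono[OF that, of "\<bar>x\<bar>"] by (simp add: abs_mult)
    have "?e \<xi> * \<bar>x * sinc (x * \<xi>)\<bar> \<le> ?e \<xi> * \<bar>x\<bar>" for \<xi>
      by (rule mult_left_mono[OF xc[OF sinc1]]) simp
    moreover have "norm (?e \<xi> * c) = ?e \<xi> * \<bar>c\<bar>" "norm (x * (\<xi> ^ 0 * ?e \<xi>)) = ?e \<xi> * \<bar>x\<bar>" for \<xi> c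
      by (simp_all add: abs_mult)
    ultimately show "AE \<xi> in lborel. \<xi> \<in> {0<..} \<longrightarrow> norm (?p \<xi>) \<le> norm (x * (\<xi> ^ 0 * ?e \<xi>))"
      by (intro AE_I2 impI) (simp only:)
  qed
  have intg: "set_integrable lborel {0<..} ?g"
    using quartic_moment(1)[OF assms(1), of 3] by (intro set_integrable_mult_right)
  have qg: "\<bar>?q \<xi>\<bar> \<le> ?g \<xi>" if "0 < \<xi>" for \<xi>
    using mult_left_mono[OF S[of "x * \<xi>"], of "4 * t * (\<xi> ^ 3 * ?e \<xi>)"] that assms(1)
    by (simp add: abs_mult mult_ac)
  have intq: "set_integrable lborel {0<..} ?q"
    by (rule set_integrable_bound[OF intg])
       (use qg in \<open>auto simp: set_borel_measurable_def intro: order_trans[OF _ abs_ge_self]\<close>)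
  have "(LBINT \<xi>=0..\<infinity>. ?p \<xi> - ?q \<xi>) = 0 - 0"
  proof (rule interval_integral_FTC_integrable[where F = "\<lambda>\<xi>. ?e \<xi> * Si (x * \<xi>)"])
    show "((\<lambda>\<xi>. ?e \<xi> * Si (x * \<xi>)) has_vector_derivative ?p \<xi> - ?q \<xi>) (at \<xi>)" for \<xi>
    proof -
      have d1: "((\<lambda>\<xi>. Si (x * \<xi>)) has_real_derivative sinc (x * \<xi>) * x) (at \<xi>)"
        by (rule DERIV_chain2[OF DERIV_Si]) (auto intro!: derivative_eq_intros)
      have d2: "(?e has_real_derivative - (4 * t * (\<xi> ^ 3 * ?e \<xi>))) (at \<xi>)"
        by (auto intro!: derivative_eq_intros)
      have "((\<lambda>\<xi>. ?e \<xi> * Si (x * \<xi>)) has_real_derivative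
         - (4 * t * (\<xi> ^ 3 * ?e \<xi>)) * Si (x * \<xi>) + sinc (x * \<xi>) * x * ?e \<xi>) (at \<xi>)"
        by (rule DERIV_mult[OF d2 d1])
      then show ?thesis
        unfolding has_real_derivative_iff_has_vector_derivative[symmetric]
        by (simp add: algebra_simps)
    qed
    show "isCont (\<lambda>\<xi>. ?p \<xi> - ?q \<xi>) \<xi>" for \<xi>
      by (intro continuous_intros isCont_o2[OF _ isCont_sinc] isCont_o2[OF _ isCont_Si])
    show "set_integrable lborel (einterval 0 \<infinity>) (\<lambda>\<xi>. ?p \<xi> - ?q \<xi>)"
      unfolding ei by (rule set_integral_diff(1)[OF intp intq])
    have "isCont (\<lambda>\<xi>. ?e \<xi> * Si (x * \<xi>)) 0"
      by (intro continuous_intros isCont_o2[OF _ isCont_Si])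
    then have "((\<lambda>\<xi>. ?e \<xi> * Si (x * \<xi>)) \<longlongrightarrow> 0) (at_right 0)"
      by (auto simp: isCont_def intro: tendsto_within_subset)
    then show "(((\<lambda>\<xi>. ?e \<xi> * Si (x * \<xi>)) \<circ> real_of_ereal) \<longlongrightarrow> 0) (at_right 0)"
      unfolding zero_ereal_def ereal_tendsto_simps .
    have "(?e \<longlongrightarrow> 0) at_top" using assms(1) by real_asymp
    then have "((\<lambda>\<xi>. ?e \<xi> * Si (x * \<xi>)) \<longlongrightarrow> 0) at_top"
      using S by (auto intro!: lim_null_mult_right_bounded[where B = S])
    then show "(((\<lambda>\<xi>. ?e \<xi> * Si (x * \<xi>)) \<circ> real_of_ereal) \<longlongrightarrow> 0) (at_left \<infinity>)"
      unfolding ereal_tendsto_simps .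
  qed simp
  then have "(LBINT \<xi>:{0<..}. ?p \<xi>) = (LBINT \<xi>:{0<..}. ?q \<xi>)"
    unfolding interval_lebesgue_integral_0_infty set_integral_diff(2)[OF intp intq] by simp
  moreover have "\<bar>LBINT \<xi>:{0<..}. ?q \<xi>\<bar> \<le> (LBINT \<xi>:{0<..}. ?g \<xi>)"
    by (rule abs_set_integral_le[OF intg]) (use qg in auto)
  moreover have "(LBINT \<xi>:{0<..}. ?g \<xi>) = S"
  proof -
    have "(LBINT \<xi>:{0<..}. ?g \<xi>) = S * (4 * t) * (1 / 4 * t powr (- 1))"
      using quartic_moment(2)[OF assms(1), of 3] Gamma_fact[of 0, where 'a = real]
      by (simp add: interval_lebesgue_integral_0_infty)
    then show ?thesis using assms(1) by (simp add: powr_minus)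
  qed
  moreover have "(LBINT \<xi>:{0<..}. ?e \<xi> * (sin (x * \<xi>) / \<xi>)) = (LBINT \<xi>:{0<..}. ?p \<xi>)"
    by (rule set_lebesgue_integral_cong) (auto simp: pe)
  ultimately show ?thesis unfolding interval_lebesgue_integral_0_infty by linarith
qed

text \<open>Differentiating under the integral would produce \<open>sin (x * \<xi>) / \<xi>\<close>, which is only conditionally
  integrable; splitting off \<open>(1 - cos (x * \<xi>)) / \<xi>\<^sup>2\<close>, whose integral is explicit, leaves a damped
  integrand.\<close>

lemma one_minus_exp_cos_integral_has_derivative:
  fixes t x S :: real
  assumes "0 < t" "0 \<le> x" and S: "\<And>y. \<bar>Si y\<bar> \<le> S"
  obtains D where "((\<lambda>z. LBINT \<xi>=0..\<infinity>. (1 - exp (- (\<xi> ^ 4 * t))) / \<xi>\<^sup>2 * cos (z * \<xi>))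
      has_real_derivative D) (at x within {0..})" and "\<bar>D\<bar> \<le> pi / 2 + S"
proof -
  let ?A = "\<lambda>z. LBINT \<xi>=0..\<infinity>. (1 - exp (- (\<xi> ^ 4 * t))) / \<xi>\<^sup>2 * cos (z * \<xi>)"
  let ?B = "\<lambda>z. LBINT \<xi>=0..\<infinity>. exp (- (\<xi> ^ 4 * t)) * ((1 - cos (z * \<xi>)) / \<xi>\<^sup>2)"
  let ?b = "LBINT \<xi>=0..\<infinity>. exp (- (\<xi> ^ 4 * t)) * (sin (x * \<xi>) / \<xi>)"
  \<comment> \<open>The restriction to z \<ge> 0 selects one branch of \<bar>z\<bar> in the explicit
    integral. The kink of \<bar>z\<bar> at 0 is why the derivative is taken within the half-line; it
    produces the prescribed slope tan \<beta> of the first part of U at x = 0.\<close>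
  have A: "?A z = Gamma (3 / 4) * t powr (1 / 4) - pi / 2 * z + ?B z" if "0 \<le> z" for z
  proof -
    let ?f = "\<lambda>\<xi>::real. (1 - exp (- (\<xi> ^ 4 * t))) / \<xi>\<^sup>2"
    let ?c = "\<lambda>\<xi>::real. (1 - cos (z * \<xi>)) / \<xi>\<^sup>2"
    let ?h = "\<lambda>\<xi>::real. exp (- (\<xi> ^ 4 * t)) * ?c \<xi>"
    note i = one_minus_exp_quartic_integral(1)[OF assms(1)] one_minus_cos_integral(1)[of z]
      smoothed_cos_integral_has_derivative(1)[OF assms(1), of z]
    have "?A z = (LBINT \<xi>:{0<..}. ?f \<xi> - ?c \<xi> + ?h \<xi>)"
      unfolding interval_lebesgue_integral_0_infty
      by (rule set_lebesgue_integral_cong) (auto simp: field_simps)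
    also have "\<dots> = (LBINT \<xi>:{0<..}. ?f \<xi>) - (LBINT \<xi>:{0<..}. ?c \<xi>) + (LBINT \<xi>:{0<..}. ?h \<xi>)"
      by (simp only: set_integral_add(2)[OF set_integral_diff(1)[OF i(1,2)] i(3)] set_integral_diff(2)[OF i(1,2)])
    also have "(LBINT \<xi>:{0<..}. ?f \<xi>) = Gamma (3 / 4) * t powr (1 / 4)"
      using one_minus_exp_quartic_integral(2)[OF assms(1)] by (simp add: interval_lebesgue_integral_0_infty)
    also have "(LBINT \<xi>:{0<..}. ?c \<xi>) = pi / 2 * z"
      using one_minus_cos_integral(2)[of z] that by (simp add: interval_lebesgue_integral_0_infty)
    finally show ?thesis by (simp add: interval_lebesgue_integral_0_infty)
  qed
  have "(?B has_real_derivative ?b) (at x within {0..})"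
    using smoothed_cos_integral_has_derivative(2)[OF assms(1)] by (rule has_field_derivative_at_within)
  then have "((\<lambda>z. Gamma (3 / 4) * t powr (1 / 4) - pi / 2 * z + ?B z) has_real_derivative - (pi / 2) + ?b) (at x within {0..})"
    by (auto intro!: derivative_eq_intros)
  then have "(?A has_real_derivative - (pi / 2) + ?b) (at x within {0..})"
    by (rule has_field_derivative_transform_within[where d = 1]) (use A assms in auto)
  moreover have "\<bar>- (pi / 2) + ?b\<bar> \<le> pi / 2 + S"
    using abs_smoothed_Dirichlet_integral_le[OF assms(1) S, of x] pi_gt_zero by linarith
  ultimately show ?thesis by (rule that)
qed

section \<open>The source term of the boundary part\<close>

lemma abs_Green_le:
  assumes "0 < t"
  shows "\<bar>pi * Green x t\<bar> \<le> Gamma (1 / 4) / 4 * t powr (- 1 / 4)"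
proof -
  have "\<bar>LBINT \<xi>:{0<..}. exp (- (\<xi> ^ 4 * t)) * cos (x * \<xi>)\<bar> \<le> (LBINT \<xi>:{0<..}. \<xi> ^ 0 * exp (- (\<xi> ^ 4 * t)))"
  proof (rule abs_set_integral_le[OF quartic_moment(1)[OF assms, of 0]])
    show "\<bar>exp (- (\<xi> ^ 4 * t)) * cos (x * \<xi>)\<bar> \<le> \<xi> ^ 0 * exp (- (\<xi> ^ 4 * t))" for \<xi>
      using mult_left_mono[OF abs_cos_le_one[of "x * \<xi>"], of "exp (- (\<xi> ^ 4 * t))"]
      by (auto simp: abs_mult)
  qed
  also have "\<dots> = Gamma (1 / 4) / 4 * t powr (- 1 / 4)"
    using quartic_moment(2)[OF assms, of 0] by (simp add: interval_lebesgue_integral_0_infty)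
  finally show ?thesis by (simp add: Green_def interval_lebesgue_integral_0_infty)
qed

lemma boundary_source_integral_eq:
  fixes q :: "real \<Rightarrow> real"
  assumes "0 < t"
  shows "(LBINT \<tau>=0..t. (LBINT \<xi>=0..\<infinity>. q \<tau> * exp (- (\<xi> ^ 4 * (t - \<tau>))) * cos (x * \<xi>)))
         = (LBINT \<tau>:{0<..<t}. q \<tau> * (pi * Green x (t - \<tau>)))"
proof -
  have "(LBINT \<tau>=0..t. (LBINT \<xi>=0..\<infinity>. q \<tau> * exp (- (\<xi> ^ 4 * (t - \<tau>))) * cos (x * \<xi>)))
        = (LBINT \<tau>:{0<..<t}. (LBINT \<xi>=0..\<infinity>. q \<tau> * exp (- (\<xi> ^ 4 * (t - \<tau>))) * cos (x * \<xi>)))"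
    using assms by (simp add: interval_lebesgue_integral_def zero_ereal_def)
  also have "\<dots> = (LBINT \<tau>:{0<..<t}. q \<tau> * (pi * Green x (t - \<tau>)))"
    by (simp add: Green_def interval_lebesgue_integral_0_infty mult.assoc)
  finally show ?thesis .
qed

text \<open>The Green function is O(s powr (- 1 / 4)) uniformly in x, so the time integral is a Beta
  integral of order t powr (1 / 4), the same as the main term. Only the smallness of K can make this
  contribution negligible.\<close>

lemma boundary_source_integral_bound:
  fixes q :: "real \<Rightarrow> real"
  assumes "0 < t" and q: "\<And>\<tau>. 0 < \<tau> \<Longrightarrow> \<tau> < t \<Longrightarrow> \<bar>q \<tau>\<bar> \<le> K * \<tau> powr (- 1 / 2)"
  shows "\<bar>LBINT \<tau>=0..t. (LBINT \<xi>=0..\<infinity>. q \<tau> * exp (- (\<xi> ^ 4 * (t - \<tau>))) * cos (x * \<xi>))\<bar>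
         \<le> K * (Gamma (1 / 4) / 4) * Beta (1 / 2) (3 / 4) * t powr (1 / 4)"
proof -
  let ?g = "\<lambda>\<tau>. K * (Gamma (1 / 4) / 4) * (\<tau> powr (1 / 2 - 1) * (t - \<tau>) powr (3 / 4 - 1))"
  have "\<bar>LBINT \<tau>:{0<..<t}. q \<tau> * (pi * Green x (t - \<tau>))\<bar> \<le> (LBINT \<tau>:{0<..<t}. ?g \<tau>)"
  proof (rule abs_set_integral_le)
    show "set_integrable lborel {0<..<t} ?g"
      by (intro set_integrable_mult_right Beta_set_integral) (use assms in auto)
    fix \<tau> assume "\<tau> \<in> {0<..<t}"
    then have "\<bar>q \<tau> * (pi * Green x (t - \<tau>))\<bar> \<le> (K * \<tau> powr (- 1 / 2)) * (Gamma (1 / 4) / 4 * (t - \<tau>) powr (- 1 / 4))"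
      unfolding abs_mult[of "q \<tau>"] using q[of \<tau>] abs_Green_le[of "t - \<tau>" x]
      by (intro mult_mono) auto
    then show "\<bar>q \<tau> * (pi * Green x (t - \<tau>))\<bar> \<le> ?g \<tau>" by (simp add: mult_ac)
  qed
  also have "\<dots> = K * (Gamma (1 / 4) / 4) * (t powr (1 / 2 + 3 / 4 - 1) * Beta (1 / 2) (3 / 4))"
    using Beta_set_integral(2)[of "1 / 2" "3 / 4" t] assms(1)
    by (subst set_integral_mult_right) simp
  finally show ?thesis unfolding boundary_source_integral_eq[OF assms(1)] by (simp add: mult_ac)
qed

text \<open>Differentiating the time integral requires genuine integrability for nearby x, so the
  inner \<xi>-integrals must be measurable in s. This follows from joint measurability of their
  integrands.\<close>

lemma measurable_quartic_kernel:
  fixes x :: real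
  shows "(\<lambda>s. LBINT \<xi>:{0<..}. exp (- (\<xi> ^ 4 * s)) * cos (x * \<xi>)) \<in> borel_measurable borel"
  "(\<lambda>s. LBINT \<xi>:{0<..}. \<xi> * exp (- (\<xi> ^ 4 * s)) * sin (x * \<xi>)) \<in> borel_measurable borel"
proof -
  have sets: "sets (borel \<Otimes>\<^sub>M lborel) = sets (borel \<Otimes>\<^sub>M borel :: (real \<times> real) measure)"
    by (rule sets_pair_measure_cong) auto
  have 1: "(\<lambda>(s, \<xi>::real). indicator {0<..} \<xi> *\<^sub>R (exp (- (\<xi> ^ 4 * s)) * cos (x * \<xi>))) \<in> borel_measurable (borel \<Otimes>\<^sub>M borel)"
    "(\<lambda>(s, \<xi>::real). indicator {0<..} \<xi> *\<^sub>R (\<xi> * exp (- (\<xi> ^ 4 * s)) * sin (x * \<xi>))) \<in> borel_measurable (borel \<Otimes>\<^sub>M borel)"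
    by measurable
  show "(\<lambda>s. LBINT \<xi>:{0<..}. exp (- (\<xi> ^ 4 * s)) * cos (x * \<xi>)) \<in> borel_measurable borel"
    "(\<lambda>s. LBINT \<xi>:{0<..}. \<xi> * exp (- (\<xi> ^ 4 * s)) * sin (x * \<xi>)) \<in> borel_measurable borel"
    unfolding set_lebesgue_integral_def
    by (rule lborel.borel_measurable_lebesgue_integral, unfold measurable_cong_sets[OF sets refl], fact 1)+
qed

text \<open>One spatial derivative worsens the kernel to O(s powr (- 1 / 2)). Together with the
  weight of q this gives the scale-free integral Beta (1 / 2) (1 / 2) = pi, so the bound does not
  depend on t. The factor 2 is a coarse replacement of sqrt pi / 4.\<close>

lemma boundary_source_integral_has_derivative:
  fixes q :: "real \<Rightarrow> real"
  assumes "0 < t" and "0 \<le> K"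
    and q: "\<And>\<tau>. 0 < \<tau> \<Longrightarrow> \<tau> < t \<Longrightarrow> \<bar>q \<tau>\<bar> \<le> K * \<tau> powr (- 1 / 2)"
    and meas: "set_borel_measurable lborel {0<..<t} q"
  obtains D where "((\<lambda>z. LBINT \<tau>=0..t. (LBINT \<xi>=0..\<infinity>. q \<tau> * exp (- (\<xi> ^ 4 * (t - \<tau>))) * cos (z * \<xi>)))
      has_real_derivative D) (at x)" and "\<bar>D\<bar> \<le> K * 2 * pi"
proof -
  let ?k = "\<lambda>z s::real. LBINT \<xi>:{0<..}. exp (- (\<xi> ^ 4 * s)) * cos (z * \<xi>)"
  let ?k' = "\<lambda>z s::real. LBINT \<xi>:{0<..}. \<xi> * exp (- (\<xi> ^ 4 * s)) * sin (z * \<xi>)"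
  let ?f = "\<lambda>z \<tau>. (indicator {0<..<t} \<tau> *\<^sub>R q \<tau>) * ?k z (t - \<tau>)"
  let ?f' = "\<lambda>z \<tau>. (indicator {0<..<t} \<tau> *\<^sub>R q \<tau>) * - ?k' z (t - \<tau>)"
  let ?g = "\<lambda>\<tau>. indicator {0<..<t} \<tau> *\<^sub>R (K * 2 * (\<tau> powr (1 / 2 - 1) * (t - \<tau>) powr (1 / 2 - 1)))"
  let ?h = "\<lambda>\<tau>. indicator {0<..<t} \<tau> *\<^sub>R (K * (Gamma (1 / 4) / 4) * (\<tau> powr (1 / 2 - 1) * (t - \<tau>) powr (3 / 4 - 1)))"
  note [measurable] = measurable_quartic_kernel meas[unfolded set_borel_measurable_def]
  have k: "?k z s = pi * Green z s" for z s by (simp add: Green_def interval_lebesgue_integral_0_infty)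
  have kd: "((\<lambda>z. ?k z s) has_real_derivative - ?k' z s) (at z)" if "0 < s" for z s
    unfolding k using DERIV_cmult[OF Green_has_derivative[OF that, of z], of pi]
    by (simp add: interval_lebesgue_integral_0_infty)
  have pi2: "sqrt pi / 4 \<le> 2"
  proof -
    have "sqrt pi \<le> 2" using pi_less_4 by (intro real_le_lsqrt) auto
    then show ?thesis by simp
  qed
  have kb: "\<bar>?k' z s\<bar> \<le> 2 * s powr (1 / 2 - 1)" if "0 < s" for z s
  proof -
    have "\<bar>?k' z s\<bar> \<le> sqrt pi / 4 * s powr (- 1 / 2)"
      using abs_sine_moment_le[OF that, of z] by (simp add: interval_lebesgue_integral_0_infty)
    also have "\<dots> \<le> 2 * s powr (- 1 / 2)" using pi2 by (intro mult_right_mono) auto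
    finally show ?thesis by simp
  qed
  have intg: "integrable lborel ?g" "(\<integral>\<tau>. ?g \<tau> \<partial>lborel) = K * 2 * pi"
  proof -
    have "Beta (1 / 2) (1 / 2 :: real) = pi"
      by (simp add: Beta_def Gamma_one_half_real)
    then have v: "(LBINT \<tau>:{0<..<t}. \<tau> powr (1 / 2 - 1) * (t - \<tau>) powr (1 / 2 - 1)) = pi"
      using Beta_set_integral(2)[of "1 / 2" "1 / 2" t] assms(1) by simp
    have "set_integrable lborel {0<..<t} (\<lambda>\<tau>. K * 2 * (\<tau> powr (1 / 2 - 1) * (t - \<tau>) powr (1 / 2 - 1)))"
      by (intro set_integrable_mult_right Beta_set_integral) (use assms in auto)
    moreover have "(LBINT \<tau>:{0<..<t}. K * 2 * (\<tau> powr (1 / 2 - 1) * (t - \<tau>) powr (1 / 2 - 1))) = K * 2 * pi"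
      by (subst set_integral_mult_right) (simp only: v)
    ultimately show "integrable lborel ?g" "(\<integral>\<tau>. ?g \<tau> \<partial>lborel) = K * 2 * pi"
      by (simp_all only: set_integrable_def set_lebesgue_integral_def)
  qed
  have inth: "integrable lborel ?h"
    unfolding set_integrable_def[symmetric]
    by (intro set_integrable_mult_right Beta_set_integral) (use assms in auto)
  have f'g: "\<bar>?f' z \<tau>\<bar> \<le> ?g \<tau>" for z \<tau>
  proof (cases "\<tau> \<in> {0<..<t}")
    case True
    then have "\<bar>q \<tau>\<bar> * \<bar>?k' z (t - \<tau>)\<bar> \<le> (K * \<tau> powr (1 / 2 - 1)) * (2 * (t - \<tau>) powr (1 / 2 - 1))"
      using q[of \<tau>] kb[of "t - \<tau>" z] \<open>0 \<le> K\<close> by (intro mult_mono) auto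
    then show ?thesis using True by (simp add: abs_mult mult_ac)
  qed simp
  have fh: "\<bar>?f z \<tau>\<bar> \<le> ?h \<tau>" for z \<tau>
  proof (cases "\<tau> \<in> {0<..<t}")
    case True
    then have "\<bar>q \<tau>\<bar> * \<bar>?k z (t - \<tau>)\<bar> \<le> (K * \<tau> powr (1 / 2 - 1)) * (Gamma (1 / 4) / 4 * (t - \<tau>) powr (3 / 4 - 1))"
      unfolding k using q[of \<tau>] abs_Green_le[of "t - \<tau>" z] \<open>0 \<le> K\<close> by (intro mult_mono) auto
    then show ?thesis using True by (simp add: abs_mult mult_ac)
  qed simp
  have "((\<lambda>z. \<integral>\<tau>. ?f z \<tau> \<partial>lborel) has_real_derivative (\<integral>\<tau>. ?f' x \<tau> \<partial>lborel)) (at x within UNIV)"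
  proof (rule has_real_derivative_integral_dominated[OF _ _ _ _ _ intg(1)])
    show "integrable lborel (?f z)" for z
    proof (rule Bochner_Integration.integrable_bound[OF inth])
      show "?f z \<in> borel_measurable lborel" by measurable
    qed (use fh in \<open>auto intro: order_trans[OF _ abs_ge_self]\<close>)
    show "?f' x \<in> borel_measurable lborel" by measurable
    show "((\<lambda>z. ?f z \<tau>) has_real_derivative ?f' z \<tau>) (at z within UNIV)" for z \<tau>
    proof (cases "\<tau> \<in> {0<..<t}")
      case True
      then show ?thesis by (intro DERIV_cmult kd) auto
    qed simp
  qed (use f'g in auto)
  moreover have "(LBINT \<tau>=0..t. (LBINT \<xi>=0..\<infinity>. q \<tau> * exp (- (\<xi> ^ 4 * (t - \<tau>))) * cos (z * \<xi>)))
      = (\<integral>\<tau>. ?f z \<tau> \<partial>lborel)" for z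
    unfolding boundary_source_integral_eq[OF assms(1)] set_lebesgue_integral_def[of lborel "{0<..<t}"] k
    by (simp add: mult.assoc)
  moreover have "\<bar>\<integral>\<tau>. ?f' x \<tau> \<partial>lborel\<bar> \<le> K * 2 * pi"
    using abs_integral_le[OF intg(1) f'g] intg(2) by simp
  ultimately show ?thesis using that by simp
qed

section \<open>Pointwise bounds for admissible solutions\<close>

lemma Dx_has_derivative:
  assumes "Dx k g differentiable_on {0..}" "0 \<le> x"
  shows "(Dx k g has_real_derivative Dx (Suc k) g x) (at x within {0..})"
  using assms
  by (auto simp: differentiable_on_def has_real_derivative_iff_has_vector_derivative
      vector_derivative_works[symmetric])

text \<open>Every x \<ge> 0 is a limit of points of the half-line to its right, so the one-sided
  derivative is unique.\<close>

lemma Dx_Suc_eqI: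
  assumes "(Dx k g has_real_derivative D) (at x within {0..})" "0 \<le> x"
  shows "Dx (Suc k) g x = D"
proof -
  have "at x within {0..} \<noteq> bot"
  proof -
    have "at_right x \<le> at x within {0..}"
      using assms(2) by (intro at_le) auto
    then show ?thesis using trivial_limit_at_right_real[of x] by (metis bot.extremum_uniqueI trivial_limit_def)
  qed
  then show ?thesis
    using assms by (auto simp: has_real_derivative_iff_has_vector_derivative intro: vector_derivative_within)
qed

text \<open>The time seminorm measures derivatives of the difference of two profiles; linearity of
  \<open>Dx\<close> turns this into a difference of derivatives, with differentiability of both
  profiles ensuring that \<open>Dx\<close> has its meaning.\<close>

lemma Dx_diff:
  assumes "\<And>j. j < k \<Longrightarrow> Dx j u differentiable_on {0..}" "\<And>j. j < k \<Longrightarrow> Dx j v differentiable_on {0..}"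
    and "0 \<le> x"
  shows "Dx k (\<lambda>x. u x - v x) x = Dx k u x - Dx k v x"
  using assms
proof (induction k arbitrary: x)
  case (Suc k)
  have "((\<lambda>x. Dx k u x - Dx k v x) has_real_derivative Dx (Suc k) u x - Dx (Suc k) v x) (at x within {0..})"
    by (intro DERIV_diff Dx_has_derivative Suc.prems) auto
  then have "(Dx k (\<lambda>x. u x - v x) has_real_derivative Dx (Suc k) u x - Dx (Suc k) v x) (at x within {0..})"
    by (rule has_field_derivative_transform_within[where d = 1]) (use Suc in auto)
  then show ?case using Suc.prems by (intro Dx_Suc_eqI)
qed simp

lemma le_sup_norm: "0 \<le> x \<Longrightarrow> ennreal \<bar>g x\<bar> \<le> sup_norm g"
  unfolding sup_norm_def by (rule SUP_upper) simp

text \<open>Only the top-order summand is kept. Its weight is \<open>T powr 0\<close>, which equals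
  1 for positive T, so the extracted bounds are free of T.\<close>

lemma le_BUC_norm: "0 < T \<Longrightarrow> 0 \<le> x \<Longrightarrow> ennreal \<bar>Dx l g x\<bar> \<le> BUC_norm T l g"
proof -
  assume *: "0 < T" "0 \<le> x"
  have "ennreal \<bar>Dx l g x\<bar> \<le> ennreal (T powr (- (real l - real l) / 4)) * sup_norm (Dx l g)"
    using * le_sup_norm by simp
  also have "\<dots> \<le> BUC_norm T l g"
    unfolding BUC_norm_def by (rule member_le_sum[of l]) auto
  finally show ?thesis .
qed

lemma le_BUC_holder_norm:
  assumes "0 \<le> x" "0 \<le> y" "x \<noteq> y"
  shows "ennreal (\<bar>Dx l g x - Dx l g y\<bar> / \<bar>x - y\<bar> powr \<gamma>) \<le> BUC_holder_norm T l \<gamma> g"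
proof -
  have "ennreal (\<bar>Dx l g x - Dx l g y\<bar> / \<bar>x - y\<bar> powr \<gamma>) \<le> holder_seminorm \<gamma> (Dx l g)"
    unfolding holder_seminorm_def by (rule SUP_upper2[of "(x, y)"]) (use assms in auto)
  then show ?thesis unfolding BUC_holder_norm_def by (simp add: add_increasing)
qed

lemma weight_mult_le:
  assumes "ennreal a * N \<le> ennreal M" "ennreal b \<le> N" "0 \<le> a" "0 \<le> b" "0 \<le> M"
  shows "a * b \<le> M"
proof -
  have "ennreal (a * b) \<le> ennreal a * N"
    using assms by (simp add: ennreal_mult mult_left_mono)
  also note assms(1)
  finally show ?thesis using assms by (simp add: ennreal_le_iff)
qed

lemma le_mult_powr_minus:
  fixes a t z K :: real
  assumes "t powr a * z \<le> K" "0 < t"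
  shows "z \<le> K * t powr (- a)"
  using assms by (simp add: powr_minus_divide field_simps)

lemma B_norm_upper: "0 < t \<Longrightarrow> t \<le> T \<Longrightarrow> ennreal (t powr \<alpha>) * N (w t) \<le> B_norm \<alpha> T N w"
  unfolding B_norm_def by (rule SUP_upper) simp

lemma C_seminorm_upper:
  "0 < s \<Longrightarrow> s < t \<Longrightarrow> t \<le> T \<Longrightarrow>
     ennreal (s powr \<alpha> / (t - s) powr \<mu>) * N (\<lambda>x. w t x - w s x) \<le> C_seminorm \<alpha> \<mu> T N w"
  unfolding C_seminorm_def by (rule SUP_upper2[of "(s, t)"]) auto

section \<open>What admissibility says about \<open>w_x\<close>, \<open>w_xx\<close> and
  \<open>w_xxx\<close>\<close>

lemma admissible_solution_norms:
  assumes "admissible_solution \<gamma> M T \<beta> w"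
  shows "B_norm ((2 + \<gamma>) / 4) T (BUC_holder_norm T 3 \<gamma>) w \<le> ennreal M"
    and "B_norm (1 / 4) T (BUC_norm T 2) w \<le> ennreal M"
proof -
  have *: "B_norm ((2 + \<gamma>) / 4) T (BUC_holder_norm T 3 \<gamma>) w
       + C_norm ((2 + \<gamma>) / 4) ((1 + \<gamma>) / 4) T (BUC_norm T 2) w \<le> ennreal M"
    using assms unfolding admissible_solution_def by blast
  then show "B_norm ((2 + \<gamma>) / 4) T (BUC_holder_norm T 3 \<gamma>) w \<le> ennreal M"
    by (rule order_trans[rotated]) simp
  \<comment> \<open>The norm of the time-Hoelder space contains a sup norm with weight \<alpha> -
    \<mu>, here 1 / 4; this is the source of the crude bound on w_xx.\<close>
  have "(2 + \<gamma>) / 4 - (1 + \<gamma>) / 4 = 1 / 4" by (simp add: diff_divide_distrib[symmetric])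
  then have "B_norm (1 / 4) T (BUC_norm T 2) w \<le> C_norm ((2 + \<gamma>) / 4) ((1 + \<gamma>) / 4) T (BUC_norm T 2) w"
    unfolding C_norm_def by (simp only:) simp
  also have "\<dots> \<le> ennreal M"
    using * by (rule order_trans[rotated]) simp
  finally show "B_norm (1 / 4) T (BUC_norm T 2) w \<le> ennreal M" .
qed

lemma admissible_solution_Dx2_bound:
  assumes "admissible_solution \<gamma> M T \<beta> w" "0 < M" "0 < t" "t \<le> T" "0 \<le> x"
  shows "\<bar>Dx 2 (w t) x\<bar> \<le> M * t powr (- 1 / 4)"
proof -
  have "t powr (1 / 4) * \<bar>Dx 2 (w t) x\<bar> \<le> M"
    by (rule weight_mult_le[OF order_trans[OF B_norm_upper admissible_solution_norms(2)[OF assms(1)]] le_BUC_norm])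
       (use assms in auto)
  then show ?thesis using assms(3) by (simp add: powr_minus_divide field_simps)
qed

lemma admissible_solution_Dx3_holder:
  assumes "admissible_solution \<gamma> M T \<beta> w" "0 < M" "0 < t" "t \<le> T" "0 \<le> x" "0 \<le> y"
  shows "\<bar>Dx 3 (w t) x - Dx 3 (w t) y\<bar> \<le> M * t powr (- (2 + \<gamma>) / 4) * \<bar>x - y\<bar> powr \<gamma>"
proof (cases "x = y")
  case False
  have "t powr ((2 + \<gamma>) / 4) * (\<bar>Dx 3 (w t) x - Dx 3 (w t) y\<bar> / \<bar>x - y\<bar> powr \<gamma>) \<le> M"
    by (rule weight_mult_le[OF order_trans[OF B_norm_upper admissible_solution_norms(1)[OF assms(1)]] le_BUC_holder_norm])
       (use assms False in auto)
  then have "\<bar>Dx 3 (w t) x - Dx 3 (w t) y\<bar> / \<bar>x - y\<bar> powr \<gamma> \<le> M * t powr (- ((2 + \<gamma>) / 4))"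
    using assms(3) by (rule le_mult_powr_minus)
  then show ?thesis using False by (simp only: minus_divide_left) (simp add: divide_le_eq)
qed simp

lemma admissible_solution_differentiable:
  assumes "admissible_solution \<gamma> M T \<beta> w" "0 < t" "t \<le> T" "k < 3"
  shows "Dx k (w t) differentiable_on {0..}"
proof -
  have "w t \<in> BUC_holder 3 \<gamma>"
    using assms unfolding admissible_solution_def B_space_def by auto
  then show ?thesis using assms(4) by (auto simp: BUC_holder_def BUC_def)
qed

text \<open>The weighted time seminorm degenerates only at time 0, so on compact parts of the open
  interval it is an ordinary Hoelder condition. Continuity of the trace serves to make the boundary
  source measurable.\<close>

lemma admissible_solution_Dx2_continuous:
  assumes adm: "admissible_solution \<gamma> M T \<beta> w" and "0 < \<gamma>"
  shows "continuous_on {0<..<T} (\<lambda>t. Dx 2 (w t) 0)"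
proof -
  let ?p = "\<lambda>t. Dx 2 (w t) 0"
  let ?\<alpha> = "(2 + \<gamma>) / 4" and ?\<mu> = "(1 + \<gamma>) / 4"
  have "C_seminorm ?\<alpha> ?\<mu> T (BUC_norm T 2) w < \<infinity>"
    using adm unfolding admissible_solution_def C_space_def by blast
  then obtain C where C: "0 \<le> C" "C_seminorm ?\<alpha> ?\<mu> T (BUC_norm T 2) w = ennreal C"
    by (cases "C_seminorm ?\<alpha> ?\<mu> T (BUC_norm T 2) w") auto
  have hoelder: "\<bar>?p t - ?p s\<bar> \<le> C * s powr (- ?\<alpha>) * (t - s) powr ?\<mu>" if st: "0 < s" "s < t" "t < T" for s t
  proof -
    have "Dx 2 (\<lambda>x. w t x - w s x) 0 = ?p t - ?p s"
      by (rule Dx_diff) (use st in \<open>auto intro!: admissible_solution_differentiable[OF adm]\<close>)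
    moreover have "s powr ?\<alpha> / (t - s) powr ?\<mu> * \<bar>Dx 2 (\<lambda>x. w t x - w s x) 0\<bar> \<le> C"
      by (rule weight_mult_le[OF order_trans[OF C_seminorm_upper eq_refl[OF C(2)]] le_BUC_norm])
         (use st C in auto)
    ultimately have "s powr ?\<alpha> * (\<bar>?p t - ?p s\<bar> / (t - s) powr ?\<mu>) \<le> C" by simp
    then have "\<bar>?p t - ?p s\<bar> / (t - s) powr ?\<mu> \<le> C * s powr (- ?\<alpha>)"
      using st(1) by (rule le_mult_powr_minus)
    then show ?thesis using st by (simp add: divide_le_eq)
  qed
  have "isCont ?p a" if a: "a \<in> {0<..<T}" for a
  proof -
    \<comment> \<open>Times above a / 2 keep the weight s powr (- \<alpha>) bounded. The earlier of
      the two times carries the weight, which separates the cases s < a and a < s.\<close>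
    let ?g = "\<lambda>s. C * (a / 2) powr (- ?\<alpha>) * \<bar>s - a\<bar> powr ?\<mu>"
    have le: "\<bar>?p s - ?p a\<bar> \<le> ?g s" if s: "a / 2 < s" "s < T" for s
    proof -
      have mono: "r powr (- ?\<alpha>) \<le> (a / 2) powr (- ?\<alpha>)" if "a / 2 < r" for r
        using that a \<open>0 < \<gamma>\<close> by (intro powr_mono2') auto
      consider "s < a" | "s = a" | "a < s" by linarith
      then show ?thesis
      proof cases
        case 1
        have "\<bar>?p s - ?p a\<bar> \<le> C * s powr (- ?\<alpha>) * (a - s) powr ?\<mu>"
          using hoelder[of s a] 1 s a by (simp add: abs_minus_commute)
        also have "\<dots> \<le> C * (a / 2) powr (- ?\<alpha>) * (a - s) powr ?\<mu>"
          using mono[of s] s C(1) by (intro mult_right_mono mult_left_mono) auto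
        finally show ?thesis using 1 by simp
      next
        case 3
        have "\<bar>?p s - ?p a\<bar> \<le> C * a powr (- ?\<alpha>) * (s - a) powr ?\<mu>"
          using hoelder[of a s] 3 s a by simp
        also have "\<dots> \<le> C * (a / 2) powr (- ?\<alpha>) * (s - a) powr ?\<mu>"
          using mono[of a] a C(1) by (intro mult_right_mono mult_left_mono) auto
        finally show ?thesis using 3 by simp
      qed simp
    qed
    have "\<forall>\<^sub>F s in at a. s \<in> {a / 2<..<T}"
      using a by (intro eventually_at_in_open') auto
    then have "\<forall>\<^sub>F s in at a. norm (?p s - ?p a) \<le> ?g s"
      by eventually_elim (use le in auto)
    moreover have "(?g \<longlongrightarrow> 0) (at a)"
    proof -
      have "((\<lambda>s. \<bar>s - a\<bar>) \<longlongrightarrow> 0) (at a)"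
        by (intro tendsto_rabs_zero LIM_zero tendsto_ident_at)
      then have "((\<lambda>s. \<bar>s - a\<bar> powr ?\<mu>) \<longlongrightarrow> 0 powr ?\<mu>) (at a)"
        by (rule tendsto_powr'[OF _ tendsto_const]) (use \<open>0 < \<gamma>\<close> in auto)
      then show ?thesis by (intro tendsto_mult_right_zero) simp
    qed
    ultimately have "((\<lambda>s. ?p s - ?p a) \<longlongrightarrow> 0) (at a)"
      by (rule Lim_null_comparison)
    then show ?thesis unfolding isCont_def by (rule LIM_zero_cancel)
  qed
  then show ?thesis by (auto intro: continuous_at_imp_continuous_on)
qed

lemma admissible_solution_source_measurable:
  assumes "admissible_solution \<gamma> M T \<beta> w" "0 < \<gamma>" "t \<le> T"
  shows "set_borel_measurable lborel {0<..<t} (\<lambda>\<tau>. (Dx 2 (w \<tau>) 0)\<^sup>2)"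
proof -
  have "continuous_on {0<..<t} (\<lambda>\<tau>. (Dx 2 (w \<tau>) 0)\<^sup>2)"
    by (intro continuous_intros continuous_on_subset[OF admissible_solution_Dx2_continuous[OF assms(1,2)]])
       (use assms(3) in auto)
  then show ?thesis
    unfolding set_borel_measurable_def 
    by (subst measurable_lborel2, intro borel_measurable_continuous_on_indicator) auto
qed

lemma square_weight_bound:
  fixes p c t :: real
  assumes "\<bar>p\<bar> \<le> c * t powr (- 1 / 4)" "0 < t"
  shows "p\<^sup>2 \<le> c\<^sup>2 * t powr (- 1 / 2)"
proof -
  have "\<bar>p\<bar>\<^sup>2 \<le> (c * t powr (- 1 / 4))\<^sup>2"
    using assms(1) by (rule power_mono) simp
  moreover have "(t powr (- 1 / 4))\<^sup>2 = t powr (- 1 / 2)"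
    unfolding power2_eq_square powr_add[symmetric] by simp
  ultimately show ?thesis unfolding power_mult_distrib by (simp only: power2_abs)
qed

lemma c_beta_bounds:
  assumes "0 \<le> tan \<beta>"
  shows "0 \<le> c_beta \<beta>" "c_beta \<beta> \<le> 3 * tan \<beta>"
proof -
  have "1 \<le> 1 + (tan \<beta>)\<^sup>2" by simp
  then have "3 * tan \<beta> / (1 + (tan \<beta>)\<^sup>2) \<le> 3 * tan \<beta> / 1"
    using assms by (intro divide_left_mono) (auto simp: add_pos_nonneg)
  then show "c_beta \<beta> \<le> 3 * tan \<beta>" unfolding c_beta_def by simp
  show "0 \<le> c_beta \<beta>" unfolding c_beta_def using assms by simp
qed

text \<open>Admissibility bounds w_x - U_x by tan \<beta>, so the slope of U remains. Its explicit
  part contributes (1 + 2 * S / pi) * tan \<beta>. In the source part c_beta \<le> 3 * tan \<beta>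
  supplies the factor, so the crude bound M on the weighted w_xx is enough and yields
  \<open>12 * M\<^sup>2 * tan \<beta>\<close>.\<close>

lemma admissible_solution_Dx1_bound:
  assumes adm: "admissible_solution \<gamma> M T \<beta> w" and "0 < \<gamma>" "0 < M" "0 < t" "t \<le> T" "0 \<le> x"
    and b: "0 < tan \<beta>" and S: "\<And>y. \<bar>Si y\<bar> \<le> S"
  shows "\<bar>Dx 1 (w t) x\<bar> \<le> (2 + 2 * S / pi + 12 * M\<^sup>2) * tan \<beta>"
proof -
  let ?q = "\<lambda>\<tau>. (Dx 2 (w \<tau>) 0)\<^sup>2"
  let ?V = "\<lambda>z. LBINT \<tau>=0..t. (LBINT \<xi>=0..\<infinity>. ?q \<tau> * exp (- (\<xi> ^ 4 * (t - \<tau>))) * cos (z * \<xi>))"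
  have q: "\<bar>?q \<tau>\<bar> \<le> M\<^sup>2 * \<tau> powr (- 1 / 2)" if "0 < \<tau>" "\<tau> < t" for \<tau>
    using square_weight_bound[OF admissible_solution_Dx2_bound[OF adm \<open>0 < M\<close>, of \<tau> 0]] that \<open>t \<le> T\<close> by simp
  obtain D2 where D2: "(?V has_real_derivative D2) (at x)" "\<bar>D2\<bar> \<le> M\<^sup>2 * 2 * pi"
    using boundary_source_integral_has_derivative[OF \<open>0 < t\<close> _ q
        admissible_solution_source_measurable[OF adm \<open>0 < \<gamma>\<close> \<open>t \<le> T\<close>]] by auto
  obtain D1 where D1: "((\<lambda>z. LBINT \<xi>=0..\<infinity>. (1 - exp (- (\<xi> ^ 4 * t))) / \<xi>\<^sup>2 * cos (z * \<xi>))
      has_real_derivative D1) (at x within {0..})" "\<bar>D1\<bar> \<le> pi / 2 + S"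
    using one_minus_exp_cos_integral_has_derivative[OF \<open>0 < t\<close> \<open>0 \<le> x\<close> S] .
  have "(bdry_part \<beta> w t has_real_derivative - (2 * tan \<beta> / pi) * D1 + 2 * c_beta \<beta> / pi * D2) (at x within {0..})"
    unfolding bdry_part_def[abs_def]
    by (intro DERIV_add DERIV_cmult D1(1) has_field_derivative_at_within[OF D2(1)])
  then have eq: "Dx 1 (bdry_part \<beta> w t) x = - (2 * tan \<beta> / pi) * D1 + 2 * c_beta \<beta> / pi * D2"
    using Dx_Suc_eqI[of 0 "bdry_part \<beta> w t"] \<open>0 \<le> x\<close> by simp
  have "ennreal \<bar>Dx 1 (w t) x - Dx 1 (bdry_part \<beta> w t) x\<bar> \<le> sup_norm (\<lambda>x. Dx 1 (w t) x - Dx 1 (bdry_part \<beta> w t) x)"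
    using \<open>0 \<le> x\<close> by (rule le_sup_norm)
  also have "\<dots> \<le> (SUP t\<in>{0<..T}. sup_norm (\<lambda>x. Dx 1 (w t) x - Dx 1 (bdry_part \<beta> w t) x))"
    by (rule SUP_upper) (use assms in auto)
  also have "\<dots> \<le> ennreal (tan \<beta>)"
    using adm unfolding admissible_solution_def by blast
  finally have diff: "\<bar>Dx 1 (w t) x - Dx 1 (bdry_part \<beta> w t) x\<bar> \<le> tan \<beta>"
    using b by (simp add: ennreal_le_iff)
  have "\<bar>- (2 * tan \<beta> / pi) * D1\<bar> = 2 * tan \<beta> / pi * \<bar>D1\<bar>" using b by (simp add: abs_mult)
  also have "\<dots> \<le> 2 * tan \<beta> / pi * (pi / 2 + S)" using D1(2) b by (intro mult_left_mono) auto
  also have "\<dots> = (1 + 2 * S / pi) * tan \<beta>" by (simp add: field_simps)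
  finally have 1: "\<bar>- (2 * tan \<beta> / pi) * D1\<bar> \<le> (1 + 2 * S / pi) * tan \<beta>" .
  have "\<bar>2 * c_beta \<beta> / pi * D2\<bar> = 2 * c_beta \<beta> / pi * \<bar>D2\<bar>" using c_beta_bounds[of \<beta>] b by (simp add: abs_mult)
  also have "\<dots> \<le> 2 * (3 * tan \<beta>) / pi * (M\<^sup>2 * 2 * pi)"
  proof (rule mult_mono[OF _ D2(2)])
    show "2 * c_beta \<beta> / pi \<le> 2 * (3 * tan \<beta>) / pi"
      using c_beta_bounds[of \<beta>] b by (intro divide_right_mono) auto
  qed (use b in auto)
  also have "\<dots> = 12 * M\<^sup>2 * tan \<beta>" by simp
  finally have 2: "\<bar>2 * c_beta \<beta> / pi * D2\<bar> \<le> 12 * M\<^sup>2 * tan \<beta>" .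
  have "\<bar>u\<bar> \<le> b + (p + r)" if "\<bar>u - (X + Y)\<bar> \<le> b" "\<bar>X\<bar> \<le> p" "\<bar>Y\<bar> \<le> r" for u X Y b p r :: real
    using that by linarith
  from this[OF diff[unfolded eq] 1 2] show ?thesis by (simp add: algebra_simps)
qed

section \<open>The boundary value\<close>

text \<open>The coefficient of the third derivative vanishes to second order in p = w_x:
  \<open>(1 - 2 * p\<^sup>2) * (1 + p\<^sup>2)\<^sup>2\<close> equals 1 minus nonnegative terms. In
  the other summand the denominator is at least 1.\<close>

lemma abs_nonlin_le:
  assumes "\<bar>Dx 1 g x\<bar> \<le> A" "\<bar>Dx 2 g x\<bar> \<le> R" "\<bar>Dx 3 g x\<bar> \<le> B"
  shows "\<bar>nonlin g x\<bar> \<le> 2 * A\<^sup>2 * B + 3 * A * R\<^sup>2"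
proof -
  define p r s where "p = Dx 1 g x" and "r = Dx 2 g x" and "s = Dx 3 g x"
  have pA: "p\<^sup>2 \<le> A\<^sup>2" and rR: "r\<^sup>2 \<le> R\<^sup>2" and A0: "0 \<le> A" and B0: "0 \<le> B"
    using power_mono[OF assms(1), of 2] power_mono[OF assms(2), of 2] assms(1,3)
    by (auto simp: p_def r_def)
  have c1: "\<bar>1 / (1 + p\<^sup>2)\<^sup>2 - 1\<bar> \<le> 2 * p\<^sup>2"
  proof -
    have "1 \<le> (1 + p\<^sup>2)\<^sup>2" by (simp add: one_le_power)
    moreover have "(1 - 2 * p\<^sup>2) * (1 + p\<^sup>2)\<^sup>2 \<le> 1"
    proof -
      have "(1 - 2 * p\<^sup>2) * (1 + p\<^sup>2)\<^sup>2 = 1 - (3 * (p\<^sup>2)\<^sup>2 + 2 * (p\<^sup>2)\<^sup>2 * p\<^sup>2)"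
        by (simp add: power2_eq_square algebra_simps)
      moreover have "0 \<le> 3 * (p\<^sup>2)\<^sup>2 + 2 * (p\<^sup>2)\<^sup>2 * p\<^sup>2" by simp
      ultimately show ?thesis by linarith
    qed
    moreover have "\<bar>1 / D - 1\<bar> \<le> e" if "1 \<le> D" "(1 - e) * D \<le> 1" for D e :: real
    proof -
      have "1 / D \<le> 1" using that(1) by (simp add: divide_le_eq)
      moreover have "1 - e \<le> 1 / D" using that by (simp add: le_divide_eq)
      ultimately show ?thesis by linarith
    qed
    ultimately show ?thesis by blast
  qed
  have "\<bar>(1 / (1 + p\<^sup>2)\<^sup>2 - 1) * s\<bar> \<le> 2 * A\<^sup>2 * B"
    unfolding abs_mult by (rule mult_mono) (use c1 pA assms(3) s_def in auto)
  moreover have "\<bar>3 * p * r\<^sup>2 / (1 + p\<^sup>2) ^ 3\<bar> \<le> 3 * A * R\<^sup>2"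
  proof -
    have "1 \<le> (1 + p\<^sup>2) ^ 3" by (simp add: one_le_power)
    then have "\<bar>3 * p * r\<^sup>2 / (1 + p\<^sup>2) ^ 3\<bar> \<le> \<bar>3 * p * r\<^sup>2\<bar> / 1"
      unfolding abs_divide by (intro frac_le) auto
    also have "\<dots> = 3 * \<bar>p\<bar> * r\<^sup>2" by (simp add: abs_mult)
    also have "\<dots> \<le> 3 * A * R\<^sup>2" using assms(1) rR A0 by (intro mult_mono) (auto simp: p_def)
    finally show ?thesis .
  qed
  ultimately show ?thesis
    unfolding nonlin_def p_def[symmetric] r_def[symmetric] s_def[symmetric] by linarith
qed

lemma abs_odd_ext_le:
  assumes "\<And>x. 0 \<le> x \<Longrightarrow> \<bar>\<phi> x\<bar> \<le> F"
  shows "\<bar>odd_ext \<phi> y\<bar> \<le> 2 * F"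
  using assms[of y] assms[of "- y"] assms[of 0] by (auto simp: odd_ext_def)

text \<open>This is the L1 against sup estimate for a convolution, with the kernel replaced by its
  integrable majorant, reflected and translated to y.\<close>

lemma Green_x_convolution_bound:
  assumes "0 < s" "0 \<le> F" "\<And>y. \<bar>g y\<bar> \<le> F"
  shows "\<bar>LBINT y. Green_x (x - y) s * g y\<bar> \<le> 4 * pi * F * s powr (- 1 / 4)"
proof -
  let ?G = "\<lambda>y. 4 / (sqrt s + y\<^sup>2) * F"
  have G: "has_bochner_integral lborel (\<lambda>y. 4 / (sqrt s + y\<^sup>2) * F) (4 * pi * s powr (- 1 / 4) * F)"
    using Green_x_bound_integral[OF assms(1)] by (rule has_bochner_integral_mult_left)
  then have G': "has_bochner_integral lborel (\<lambda>y. ?G (x + (- 1) * y)) (4 * pi * s powr (- 1 / 4) * F)"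
    using lborel_has_bochner_integral_real_affine_iff[of "- 1" ?G "4 * pi * s powr (- 1 / 4) * F" x] by simp
  have "\<bar>LBINT y. Green_x (x - y) s * g y\<bar> \<le> (LBINT y. ?G (x + (- 1) * y))"
  proof (rule abs_integral_le)
    show "integrable lborel (\<lambda>y. ?G (x + (- 1) * y))" by (rule integrable.intros[OF G'])
    show "\<bar>Green_x (x - y) s * g y\<bar> \<le> ?G (x + (- 1) * y)" for y
      unfolding abs_mult using mult_mono[OF Green_x_bound[OF assms(1), of "x - y"] assms(3)[of y]] assms(1)
      by simp
  qed
  also have "\<dots> = 4 * pi * F * s powr (- 1 / 4)"
    using has_bochner_integral_integral_eq[OF G'] by (simp add: mult_ac)
  finally show ?thesis .
qed

text \<open>The odd extension at most doubles the sup norm, whence 8 * pi in place of 4 * pi; the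
  time integral is again the Beta integral that returns t powr (1 / 4).\<close>

lemma Duhamel_bound:
  assumes "0 < t" "0 \<le> F"
    and "\<And>\<tau> x. 0 < \<tau> \<Longrightarrow> \<tau> < t \<Longrightarrow> 0 \<le> x \<Longrightarrow> \<bar>\<phi> \<tau> x\<bar> \<le> F * \<tau> powr (- 1 / 2)"
  shows "\<bar>LBINT \<tau>=0..t. (LBINT y. Green_x (x - y) (t - \<tau>) * odd_ext (\<phi> \<tau>) y)\<bar>
         \<le> 8 * pi * F * Beta (1 / 2) (3 / 4) * t powr (1 / 4)"
proof -
  let ?g = "\<lambda>\<tau>. 8 * pi * F * (\<tau> powr (1 / 2 - 1) * (t - \<tau>) powr (3 / 4 - 1))"
  have "\<bar>LBINT \<tau>:{0<..<t}. (LBINT y. Green_x (x - y) (t - \<tau>) * odd_ext (\<phi> \<tau>) y)\<bar> \<le> (LBINT \<tau>:{0<..<t}. ?g \<tau>)"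
  proof (rule abs_set_integral_le)
    show "set_integrable lborel {0<..<t} ?g"
      by (intro set_integrable_mult_right Beta_set_integral) (use assms in auto)
    fix \<tau> assume \<tau>: "\<tau> \<in> {0<..<t}"
    have "\<bar>LBINT y. Green_x (x - y) (t - \<tau>) * odd_ext (\<phi> \<tau>) y\<bar>
          \<le> 4 * pi * (2 * (F * \<tau> powr (- 1 / 2))) * (t - \<tau>) powr (- 1 / 4)"
      by (rule Green_x_convolution_bound[OF _ _ abs_odd_ext_le]) (use \<tau> assms in auto)
    then show "\<bar>LBINT y. Green_x (x - y) (t - \<tau>) * odd_ext (\<phi> \<tau>) y\<bar> \<le> ?g \<tau>"
      by (simp add: mult_ac)
  qed
  also have "\<dots> = 8 * pi * F * (t powr (1 / 2 + 3 / 4 - 1) * Beta (1 / 2) (3 / 4))"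
    using Beta_set_integral(2)[of "1 / 2" "3 / 4" t] assms(1)
    by (subst set_integral_mult_right) simp
  finally show ?thesis
    using assms(1) by (simp add: interval_lebesgue_integral_def zero_ereal_def mult_ac)
qed

text \<open>With step h = \<delta> * t powr (1 / 4) the weight of the Hoelder seminorm combines with
  the powers of h, so that t factors out and \<delta> remains as a free dimensionless
  parameter.\<close>

lemma interpolation_scaled:
  fixes u u1 u2 :: "real \<Rightarrow> real"
  assumes d1: "\<And>x. 0 \<le> x \<Longrightarrow> (u has_real_derivative u1 x) (at x within {0..})"
    and d2: "\<And>x. 0 \<le> x \<Longrightarrow> (u1 has_real_derivative u2 x) (at x within {0..})"
    and A: "\<And>x. 0 \<le> x \<Longrightarrow> \<bar>u x\<bar> \<le> A"
    and H: "\<And>x y. 0 \<le> x \<Longrightarrow> 0 \<le> y \<Longrightarrow> \<bar>u2 x - u2 y\<bar> \<le> M * t powr (- (2 + \<gamma>) / 4) * \<bar>x - y\<bar> powr \<gamma>"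
    and "0 < \<gamma>" "0 < \<delta>" "0 < t" "0 \<le> x"
  shows "\<bar>u2 x\<bar> \<le> (4 * A / \<delta>\<^sup>2 + M * (2 * \<delta>) powr \<gamma>) * t powr (- 1 / 2)"
    and "\<bar>u1 x\<bar> \<le> (6 * A / \<delta> + M * \<delta> * (2 * \<delta>) powr \<gamma>) * t powr (- 1 / 4)"
proof -
  define c where "c = t powr (1 / 4)"
  have c: "0 < c" using \<open>0 < t\<close> by (simp add: c_def)
  have tp: "t powr (- 1 / 4) = 1 / c" "t powr (- 1 / 2) = 1 / c\<^sup>2" "t powr (- (2 + \<gamma>) / 4) = 1 / (c\<^sup>2 * c powr \<gamma>)"
  proof -
    show "t powr (- 1 / 4) = 1 / c" by (simp add: c_def powr_minus_divide)
    have c2: "c\<^sup>2 = t powr (1 / 2)" by (simp add: c_def power2_eq_square powr_add[symmetric])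
    then show "t powr (- 1 / 2) = 1 / c\<^sup>2" by (simp add: powr_minus_divide)
    have "- (2 + \<gamma>) / 4 = - (1 / 2 + \<gamma> / 4)" by (simp add: field_simps)
    then have "t powr (- (2 + \<gamma>) / 4) = 1 / (t powr (1 / 2) * t powr (\<gamma> / 4))"
      by (simp only: powr_minus_divide powr_add)
    then show "t powr (- (2 + \<gamma>) / 4) = 1 / (c\<^sup>2 * c powr \<gamma>)"
      unfolding c2 by (simp add: c_def powr_powr)
  qed
  have sc: "M * t powr (- (2 + \<gamma>) / 4) * (2 * (\<delta> * c)) powr \<gamma> = M * (2 * \<delta>) powr \<gamma> / c\<^sup>2"
    unfolding tp using c \<open>0 < \<delta>\<close> powr_mult[of "2 * \<delta>" c \<gamma>] by (simp add: mult.assoc)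
  have h: "0 < \<delta> * c" using c \<open>0 < \<delta>\<close> by simp
  note ip = half_line_interpolation[where u = u and ?u1.0 = u1 and ?u2.0 = u2, OF d1 d2 A H \<open>0 < \<gamma>\<close> h \<open>0 \<le> x\<close>]
  have "\<bar>u2 x\<bar> \<le> 4 * A / (\<delta> * c)\<^sup>2 + M * (2 * \<delta>) powr \<gamma> / c\<^sup>2"
    using ip(1) unfolding sc by simp
  also have "\<dots> = (4 * A / \<delta>\<^sup>2 + M * (2 * \<delta>) powr \<gamma>) * t powr (- 1 / 2)"
    unfolding tp using c \<open>0 < \<delta>\<close> by (simp add: field_simps)
  finally show "\<bar>u2 x\<bar> \<le> (4 * A / \<delta>\<^sup>2 + M * (2 * \<delta>) powr \<gamma>) * t powr (- 1 / 2)" .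
  have "\<bar>u1 x\<bar> \<le> 6 * A / (\<delta> * c) + \<delta> * c * (M * (2 * \<delta>) powr \<gamma> / c\<^sup>2)"
    using ip(2) unfolding sc by simp
  also have "\<dots> = (6 * A / \<delta> + M * \<delta> * (2 * \<delta>) powr \<gamma>) * t powr (- 1 / 4)"
    unfolding tp using c \<open>0 < \<delta>\<close> by (simp add: field_simps power2_eq_square)
  finally show "\<bar>u1 x\<bar> \<le> (6 * A / \<delta> + M * \<delta> * (2 * \<delta>) powr \<gamma>) * t powr (- 1 / 4)" .
qed

text \<open>\<open>E\<close> collects the majorants of the Duhamel and source terms, divided by tan
  \<beta> * t powr (1 / 4). It is chosen before T, \<beta>, w and t, which is what makes the later
  threshold uniform.\<close>

lemma admissible_solution_boundary_bound:
  fixes \<gamma> M :: real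
  assumes "0 < \<gamma>" "0 < M"
  obtains E where "(E \<longlongrightarrow> 0) (at_right 0)"
    and "\<And>T \<beta> w t. admissible_solution \<gamma> M T \<beta> w \<Longrightarrow> 0 < tan \<beta> \<Longrightarrow> 0 < t \<Longrightarrow> t \<le> T \<Longrightarrow>
           w t 0 \<le> (E (tan \<beta>) - 2 / pi * Gamma (3 / 4)) * tan \<beta> * t powr (1 / 4)"
proof -
  obtain S where S: "\<And>y. \<bar>Si y\<bar> \<le> S" using bounded_Si by blast
  define L where "L = 2 + 2 * S / pi + 12 * M\<^sup>2"
  define B :: real where "B = Beta (1 / 2) (3 / 4)"
  \<comment> \<open>This bounds t powr (1 / 4) times w_xx: interpolation with A = L * b and \<delta>
    = sqrt b, where b stands for tan \<beta>.\<close>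
  define \<eta> where "\<eta> = (\<lambda>b. 6 * L * sqrt b + M * sqrt b * (2 * sqrt b) powr \<gamma>)"
  \<comment> \<open>The product b * e b bounds t powr (1 / 2) times the nonlinearity: insert L * b,
    \<eta> b and the bound for w_xxx into \<open>abs_nonlin_le\<close> and divide by b.\<close>
  define e where "e = (\<lambda>b. 2 * L\<^sup>2 * b * (4 * L * b + M * 2 powr \<gamma>) + 3 * L * (\<eta> b)\<^sup>2)"
  \<comment> \<open>The factor 8 * pi is that of the Duhamel bound; 6 / pi comes from the prefactor
    2 * c_beta / pi and c_beta \<le> 3 * b.\<close>
  define E where "E = (\<lambda>b. 8 * pi * e b * B + 6 / pi * ((\<eta> b)\<^sup>2 * (Gamma (1 / 4) / 4) * B))"
  have "0 \<le> S" using S[of 0] by simp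
  then have L: "0 \<le> L" by (simp add: L_def)
  have B: "0 \<le> B" unfolding B_def Beta_def by (intro divide_nonneg_nonneg mult_nonneg_nonneg) (auto intro: less_imp_le Gamma_real_pos)
  show thesis
  proof (rule that)
    have id: "((\<lambda>b::real. b) \<longlongrightarrow> 0) (at_right 0)" by (rule tendsto_ident_at)
    have sq: "(sqrt \<longlongrightarrow> 0) (at_right 0)" using tendsto_real_sqrt[OF id] by simp
    have "((\<lambda>b. (2 * sqrt b) powr \<gamma>) \<longlongrightarrow> (2 * 0) powr \<gamma>) (at_right 0)"
      by (rule tendsto_powr'[OF tendsto_mult_left[OF sq] tendsto_const])
         (use \<open>0 < \<gamma>\<close> in \<open>auto simp: eventually_at_right_less intro!: eventually_at_rightI[of 0 1]\<close>)
    then have "(\<eta> \<longlongrightarrow> 6 * L * 0 + M * 0 * 0) (at_right 0)"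
      unfolding \<eta>_def by (intro tendsto_intros sq) simp
    then have \<eta>0: "(\<eta> \<longlongrightarrow> 0) (at_right 0)" by simp
    have "(e \<longlongrightarrow> 2 * L\<^sup>2 * 0 * (4 * L * 0 + M * 2 powr \<gamma>) + 3 * L * 0\<^sup>2) (at_right 0)"
      unfolding e_def by (intro tendsto_intros id \<eta>0)
    then have e0: "(e \<longlongrightarrow> 0) (at_right 0)" by simp
    have "(E \<longlongrightarrow> 8 * pi * 0 * B + 6 / pi * (0\<^sup>2 * (Gamma (1 / 4) / 4) * B)) (at_right 0)"
      unfolding E_def by (intro tendsto_intros e0 \<eta>0)
    then show "(E \<longlongrightarrow> 0) (at_right 0)" by simp
  next
    fix T \<beta> w t
    assume adm: "admissible_solution \<gamma> M T \<beta> w" and b0: "0 < tan \<beta>" and t: "0 < t" "t \<le> T"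
    define b where "b = tan \<beta>"
    have b: "0 < b" using b0 by (simp add: b_def)
    have eb: "0 \<le> e b" using b L \<open>0 < M\<close> by (simp add: e_def)
    have D: "\<bar>Dx 1 (w \<tau>) x\<bar> \<le> L * b" "\<bar>Dx 2 (w \<tau>) x\<bar> \<le> \<eta> b * \<tau> powr (- 1 / 4)"
      "\<bar>Dx 3 (w \<tau>) x\<bar> \<le> (4 * L * b + M * 2 powr \<gamma>) * \<tau> powr (- 1 / 2)"
      if \<tau>: "0 < \<tau>" "\<tau> < t" and x: "0 \<le> x" for \<tau> x
    proof -
      have \<tau>T: "\<tau> \<le> T" using \<tau> t by simp
      have n: "Suc 1 = 2" "Suc 2 = 3" by simp_all
      have d1: "(Dx 1 (w \<tau>) has_real_derivative Dx 2 (w \<tau>) x) (at x within {0..})" if "0 \<le> x" for x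
        using Dx_has_derivative[OF admissible_solution_differentiable[OF adm \<tau>(1) \<tau>T] that, of 1] unfolding n by simp
      have d2: "(Dx 2 (w \<tau>) has_real_derivative Dx 3 (w \<tau>) x) (at x within {0..})" if "0 \<le> x" for x
        using Dx_has_derivative[OF admissible_solution_differentiable[OF adm \<tau>(1) \<tau>T] that, of 2] unfolding n by simp
      have A: "\<bar>Dx 1 (w \<tau>) x\<bar> \<le> L * b" if "0 \<le> x" for x
        unfolding L_def b_def
        by (rule admissible_solution_Dx1_bound[OF adm assms \<tau>(1) \<tau>T that b0 S])
      show "\<bar>Dx 1 (w \<tau>) x\<bar> \<le> L * b" by (rule A[OF x])
      note ip = interpolation_scaled[where u = "Dx 1 (w \<tau>)", OF d1 d2 A
          admissible_solution_Dx3_holder[OF adm \<open>0 < M\<close> \<tau>(1) \<tau>T] \<open>0 < \<gamma>\<close> _ \<tau>(1) x]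
      \<comment> \<open>Here \<delta> = 1: the third derivative need only be bounded, since its
        coefficient in the nonlinearity already carries \<open>b\<^sup>2\<close>.\<close>
      show "\<bar>Dx 3 (w \<tau>) x\<bar> \<le> (4 * L * b + M * 2 powr \<gamma>) * \<tau> powr (- 1 / 2)"
        using ip(1)[of 1] by (simp add: mult.assoc)
      have "6 * (L * b) / sqrt b = 6 * L * sqrt b"
        using b by (simp add: real_div_sqrt flip: times_divide_eq_right)
      then show "\<bar>Dx 2 (w \<tau>) x\<bar> \<le> \<eta> b * \<tau> powr (- 1 / 4)"
        using ip(2)[of "sqrt b"] b by (simp add: \<eta>_def)
    qed
    have nl: "\<bar>nonlin (w \<tau>) x\<bar> \<le> (b * e b) * \<tau> powr (- 1 / 2)" if "0 < \<tau>" "\<tau> < t" "0 \<le> x" for \<tau> x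
    proof -
      define r where "r = \<tau> powr (- 1 / 2)"
      have r: "(\<tau> powr (- 1 / 4))\<^sup>2 = r"
        unfolding r_def power2_eq_square powr_add[symmetric] by simp
      have "\<bar>nonlin (w \<tau>) x\<bar> \<le> 2 * (L * b)\<^sup>2 * ((4 * L * b + M * 2 powr \<gamma>) * r) + 3 * (L * b) * (\<eta> b * \<tau> powr (- 1 / 4))\<^sup>2"
        unfolding r_def by (rule abs_nonlin_le[OF D[OF that]])
      also have "\<dots> = (b * e b) * r"
        unfolding power_mult_distrib r e_def by (simp add: algebra_simps power2_eq_square)
      finally show ?thesis by (simp add: r_def)
    qed
    define V where "V = (LBINT \<tau>=0..t. (LBINT \<xi>=0..\<infinity>.
        (Dx 2 (w \<tau>) 0)\<^sup>2 * exp (- (\<xi> ^ 4 * (t - \<tau>))) * cos (0 * \<xi>)))"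
    define I where "I = (LBINT \<tau>=0..t. (LBINT y. Green_x (0 - y) (t - \<tau>) * odd_ext (nonlin (w \<tau>)) y))"
    define c where "c = t powr (1 / 4)"
    have I: "\<bar>I\<bar> \<le> 8 * pi * (b * e b) * B * c"
      unfolding I_def B_def c_def by (rule Duhamel_bound[OF t(1)]) (use nl b eb in auto)
    have V: "\<bar>V\<bar> \<le> (\<eta> b)\<^sup>2 * (Gamma (1 / 4) / 4) * B * c"
      unfolding V_def B_def c_def
    proof (rule boundary_source_integral_bound[OF t(1)])
      fix \<tau> assume "0 < \<tau>" "\<tau> < t"
      then show "\<bar>(Dx 2 (w \<tau>) 0)\<^sup>2\<bar> \<le> (\<eta> b)\<^sup>2 * \<tau> powr (- 1 / 2)"
        using square_weight_bound[OF D(2)[of \<tau> 0]] by simp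
    qed
    have "w t 0 = - I + bdry_part \<beta> w t 0"
      using adm t unfolding admissible_solution_def solves_eq_def I_def by auto
    also have "bdry_part \<beta> w t 0 = - (2 * b / pi) * (Gamma (3 / 4) * c) + 2 * c_beta \<beta> / pi * V"
      using one_minus_exp_quartic_integral(2)[OF t(1)] by (simp add: bdry_part_def V_def b_def c_def)
    finally have w: "w t 0 = - I + (- (2 * b / pi) * (Gamma (3 / 4) * c) + 2 * c_beta \<beta> / pi * V)" .
    have "2 * c_beta \<beta> / pi * V \<le> 2 * c_beta \<beta> / pi * \<bar>V\<bar>"
      using c_beta_bounds[of \<beta>] b0 by (intro mult_left_mono) auto
    also have "\<dots> \<le> 2 * (3 * b) / pi * ((\<eta> b)\<^sup>2 * (Gamma (1 / 4) / 4) * B * c)"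
    proof (rule mult_mono[OF _ V])
      show "2 * c_beta \<beta> / pi \<le> 2 * (3 * b) / pi"
        using c_beta_bounds[of \<beta>] b0 by (intro divide_right_mono) (auto simp: b_def)
    qed (use b in auto)
    finally have "w t 0 \<le> 8 * pi * (b * e b) * B * c
        + (- (2 * b / pi) * (Gamma (3 / 4) * c) + 2 * (3 * b) / pi * ((\<eta> b)\<^sup>2 * (Gamma (1 / 4) / 4) * B * c))"
      unfolding w using abs_le_D2[OF I] by (intro add_mono order_refl)
    also have "\<dots> = (E b - 2 / pi * Gamma (3 / 4)) * b * c"
      unfolding E_def by (simp add: algebra_simps)
    finally show "w t 0 \<le> (E (tan \<beta>) - 2 / pi * Gamma (3 / 4)) * tan \<beta> * t powr (1 / 4)"
      by (simp add: b_def c_def)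
  qed
qed

theorem mainTheorem3:
  fixes \<gamma> M \<beta>star :: real
  assumes "0 < \<gamma>" and "\<gamma> < 1" and "0 < M"
    and "0 < \<beta>star" and "\<beta>star < pi / 2"
    and unique_existence: "\<And>T \<beta>. 0 < T \<Longrightarrow> 0 < \<beta> \<Longrightarrow> \<beta> < \<beta>star \<Longrightarrow>
          \<exists>w. admissible_solution \<gamma> M T \<beta> w \<and>
              (\<forall>v. admissible_solution \<gamma> M T \<beta> v \<longrightarrow> (\<forall>t\<in>{0<..T}. \<forall>x\<ge>0. v t x = w t x))"
  shows "\<exists>\<beta>1. 0 < \<beta>1 \<and> \<beta>1 \<le> \<beta>star \<and>
           (\<forall>\<beta> T w. 0 < \<beta> \<and> \<beta> < \<beta>1 \<and> 0 < T \<and> admissible_solution \<gamma> M T \<beta> w \<longrightarrow>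
              (\<forall>t\<in>{0<..T}. t powr (- 1 / 4) * w t 0 \<le> - (tan \<beta> / pi) * Gamma (3 / 4)) \<and>
              - (tan \<beta> / pi) * Gamma (3 / 4) < 0 \<and>
              (\<exists>t\<in>{0<..T}. \<exists>x\<ge>0. w t x \<noteq> 0))"
proof -
  have G: "0 < Gamma (3 / 4 :: real)" by (rule Gamma_real_pos) simp
  obtain E where E0: "(E \<longlongrightarrow> 0) (at_right 0)"
    and E: "\<And>T \<beta> w t. admissible_solution \<gamma> M T \<beta> w \<Longrightarrow> 0 < tan \<beta> \<Longrightarrow> 0 < t \<Longrightarrow> t \<le> T \<Longrightarrow>
           w t 0 \<le> (E (tan \<beta>) - 2 / pi * Gamma (3 / 4)) * tan \<beta> * t powr (1 / 4)"
    by (rule admissible_solution_boundary_bound[OF \<open>0 < \<gamma>\<close> \<open>0 < M\<close>]) (rule that)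
  have "\<forall>\<^sub>F b in at_right 0. E b < Gamma (3 / 4) / pi"
    by (rule order_tendstoD(2)[OF E0]) (use G in simp)
  \<comment> \<open>The leading coefficient is 2 * Gamma (3 / 4) / pi. Below b0 the error consumes
    at most half of it, and the other half is the asserted bound.\<close>
  then obtain b0 where b0: "0 < b0" "\<And>b. 0 < b \<Longrightarrow> b < b0 \<Longrightarrow> E b < Gamma (3 / 4) / pi"
    by (auto simp: eventually_at_right_field)
  show ?thesis
  \<comment> \<open>The smallness condition concerns tan \<beta>, so the threshold b0 is pulled back
    to an angle by arctan; the minimum keeps \<beta> within the range below pi / 2, where tan is
    positive and increasing.\<close>
  proof (intro exI[of _ "min \<beta>star (arctan b0)"] conjI allI impI)
    show "0 < min \<beta>star (arctan b0)" using b0 \<open>0 < \<beta>star\<close> by simp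
    show "min \<beta>star (arctan b0) \<le> \<beta>star" by simp
  next
    fix \<beta> T w
    assume asm: "0 < \<beta> \<and> \<beta> < min \<beta>star (arctan b0) \<and> 0 < T \<and> admissible_solution \<gamma> M T \<beta> w"
    have tan0: "0 < tan \<beta>" using asm \<open>\<beta>star < pi / 2\<close> by (intro tan_gt_zero) auto
    have "tan \<beta> < tan (arctan b0)"
      using asm arctan_ubound[of b0] by (intro tan_monotone) auto
    then have Eb: "E (tan \<beta>) < Gamma (3 / 4) / pi" using b0(2) tan0 by (simp add: tan_arctan)
    show neg: "- (tan \<beta> / pi) * Gamma (3 / 4) < 0" using G tan0 by simp
    show main: "\<forall>t\<in>{0<..T}. t powr (- 1 / 4) * w t 0 \<le> - (tan \<beta> / pi) * Gamma (3 / 4)"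
    proof
      fix t assume t: "t \<in> {0<..T}"
      have "t powr (- 1 / 4) * w t 0
          \<le> t powr (- 1 / 4) * ((E (tan \<beta>) - 2 / pi * Gamma (3 / 4)) * tan \<beta> * t powr (1 / 4))"
        using asm t tan0 by (intro mult_left_mono E) auto
      also have "\<dots> = (E (tan \<beta>) - 2 / pi * Gamma (3 / 4)) * tan \<beta>"
        using t by (simp add: powr_minus_divide)
      also have "\<dots> \<le> (Gamma (3 / 4) / pi - 2 / pi * Gamma (3 / 4)) * tan \<beta>"
        using Eb tan0 by (intro mult_right_mono) auto
      also have "\<dots> = - (tan \<beta> / pi) * Gamma (3 / 4)" by (simp add: field_simps)
      finally show "t powr (- 1 / 4) * w t 0 \<le> - (tan \<beta> / pi) * Gamma (3 / 4)" .
    qed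
    have "T powr (- 1 / 4) * w T 0 < 0"
      by (rule le_less_trans[OF bspec[OF main] neg]) (use asm in simp)
    then have "w T 0 \<noteq> 0" by auto
    then show "\<exists>t\<in>{0<..T}. \<exists>x\<ge>0. w t x \<noteq> 0" using asm by (intro bexI[of _ T] exI[of _ 0]) auto
  qed
qed

end
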